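(* Let $d$ be a positive integer, let $\Gamma$ be a closed subgroup of $\mathrm{E}(d)$ that contains $\mathbb{R}^d$ (the translations), and let $\Pi_1,\Pi_2$ be glueable abstract pattern spaces over $(\mathbb{R}^d,\Gamma)$. Let $\Sigma$ be a supremum-closed subshift of $\Pi_2$ that contains sufficiently many symmetric building blocks, i.e. for each $r>0$ there is a symmetric building block of $\Sigma$ for $r$. Let $\mathcal{P}\in\Pi_1$ be an abstract pattern which consists of bounded components and is Delone-deriving. Then there is an abstract pattern $\mathcal{S}\in\Sigma$ such that $\mathcal{P}$ and $\mathcal{S}$ are mutually locally derivable. Moreover, $\operatorname{supp}\mathcal{S}$ is relatively dense in $\mathbb{R}^d$.
   Context: Conventions: $\mathbb{R}^d$ carries the Euclidean metric $\rho$; $B(x,r)$ is the closed ball; $\mathrm{E}(d)\cong\mathbb{R}^d\rtimes\mathrm{O}(d)$ is the group of all isometries of $\mathbb{R}^d$; $\Gamma_x$ is the isotropy group of $x$; $\operatorname{Sym}_\Gamma\mathcal{P}=\{\gamma\in\Gamma\mid\gamma\mathcal{P}=\mathcal{P}\}$. $\mathrm{Cl}(X)$ is the set of closed subsets of $X$. Abstract pattern space: for a topological space $X$, an abstract pattern space over $X$ is a non-empty set $\Pi$ with a map $\Pi\times\mathrm{Cl}(X)\to\Pi$, $(\mathcal{P},C)\mapsto\mathcal{P}\wedge C$ (cutting-off) such that (1) $(\mathcal{P}\wedge C_1)\wedge C_2=\mathcal{P}\wedge(C_1\cap C_2)$ for all $\mathcal P\in\Pi$, $C_1,C_2\in\mathrm{Cl}(X)$;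 (2) for each $\mathcal{P}\in\Pi$ there is a closed set $C_{\mathcal P}$ (necessarily unique), denoted $\operatorname{supp}\mathcal{P}$, such that for every $C\in\mathrm{Cl}(X)$: $\mathcal{P}\wedge C=\mathcal{P}\iff C\supset C_{\mathcal P}$. If a group $\Gamma$ acts on $X$ by homeomorphisms, an abstract pattern space over $(X,\Gamma)$ is an abstract pattern space $\Pi$ over $X$ with an action of $\Gamma$ on $\Pi$ such that $(\gamma\mathcal{P})\wedge(\gamma C)=\gamma(\mathcal{P}\wedge C)$ always. A subshift of $\Pi$ is a non-empty $\Gamma$-invariant subset. Elements of $\Pi$ are called abstract patterns. Order and glueing (for $X$ a metric space): $\mathcal{P}\geqq\mathcal{Q}$ means $\mathcal{P}\wedge\operatorname{supp}\mathcal{Q}=\mathcal{Q}$; this is a partial order, and $\bigvee\Xi$ denotes the supremum of $\Xi\subset\Pi$ if it exists. For $\Xi\subset\Pi$ and $C$ closed, $\Xi\wedge C=\{\mathcal{P}\wedge C\mid\mathcal{P}\in\Xi\}$. $\mathcal{P},\mathcal{Q}\in\Pi$ are compatible if some $\mathcal{R}\in\Pi$ satisfies $\mathcal{R}\geqq\mathcal{P}$ and $\mathcal{R}\geqq\mathcal{Q}$. $\Xi\subset\Pi$ is pairwise compatible if any two of its elements are compatible, and locally finite if $\Xi\wedge B(x,r)$ is finite for all $x\in X$, $r>0$. $\Pi$ is glueable if every locally finite and pairwise compatible $\Xi\subset\Pi$ has a supremum and satisfies $\bigvee(\Xi\wedge C)=(\bigvee\Xi)\wedge C$ for all $C\in\mathrm{Cl}(X)$.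 A subset $\Sigma$ of a glueable $\Pi$ is supremum-closed if $\bigvee\Xi\in\Sigma$ for every locally finite and pairwise compatible $\Xi\subset\Sigma$. Symmetric building block: for $r>0$, a family of building blocks of $\Sigma$ for $r$ is a subset $\mathfrak{F}\subset\Sigma$ such that (1) $\mathfrak F\ne\emptyset$ and $\emptyset\neq\operatorname{supp}\mathcal{P}\subset B(0,r)$ for each $\mathcal{P}\in\mathfrak{F}$; (2) if $\gamma,\eta\in\Gamma$, $\mathcal{P},\mathcal{Q}\in\mathfrak{F}$ and $\rho(\gamma0,\eta0)>4r$, then $\gamma\mathcal{P}$ and $\eta\mathcal{Q}$ are compatible (in $\Pi_2$); (3) if $\mathcal{P},\mathcal{Q}\in\mathfrak{F}$, $\gamma\in\Gamma$, $\gamma\mathcal{P}=\mathcal{Q}$, then $\mathcal{P}=\mathcal{Q}$ and $\gamma0=0$. Elements of such a family are building blocks for $r$ (non-empty subsets of such families are again such families). A building block $\mathcal{P}$ for $r$ is symmetric if $\operatorname{Sym}_\Gamma\mathcal{P}=\Gamma_0$. Bounded components: $\mathcal{P}$ consists of bounded components if there is $R_{\mathcal P}>0$ such that for every closed $C$ and every $x\in\operatorname{supp}(\mathcal{P}\wedge C)$ we have $x\in\operatorname{supp}(\mathcal{P}\wedge C\wedge B(x,R_{\mathcal P}))$. Local derivability: let $\Gamma$ act by isometries on proper metric spaces $X,Y$, and let $\mathcal{P}_1,\mathcal{P}_2$ be abstract patterns in abstract pattern spaces over $(X,\Gamma)$, $(Y,\Gamma)$. $\mathcal{P}_2$ is locally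 derivable from $\mathcal{P}_1$ ($\mathcal{P}_1\to\mathcal{P}_2$) if there are $x_0\in X$, $y_0\in Y$, $R_0\geqq0$ such that for all $\gamma,\eta\in\Gamma$, $R\geqq0$: $(\gamma\mathcal{P}_1)\wedge B(x_0,R+R_0)=(\eta\mathcal{P}_1)\wedge B(x_0,R+R_0)$ implies $(\gamma\mathcal{P}_2)\wedge B(y_0,R)=(\eta\mathcal{P}_2)\wedge B(y_0,R)$. They are mutually locally derivable (MLD) if each is locally derivable from the other. Delone sets: $D\subset X$ is uniformly discrete if for some $r>0$, $\rho(x,y)>r$ for all distinct $x,y\in D$; relatively dense if for some $R>0$, $D$ meets the interior of $B(x,R)$ for every $x\in X$; Delone if both. The set $\mathrm{UD}(X)$ of uniformly discrete subsets is an abstract pattern space over $(X,\Gamma)$ with $D\wedge C=D\cap C$ and $\gamma D=\{\gamma x\mid x\in D\}$. $\mathcal{P}$ is Delone-deriving if some Delone set $D$ in $X$ (viewed in $\mathrm{UD}(X)$) is locally derivable from $\mathcal{P}$. *)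

theory Defs
  imports "HOL-Analysis.Analysis" "HOL-Algebra.Group_Action"
begin

section \<open>Groups of isometries\<close>

definition isometry_group :: "('a::metric_space \<Rightarrow> 'a) monoid" where
  "isometry_group =
     \<lparr>carrier = {f. bij f \<and> (\<forall>x y. dist (f x) (f y) = dist x y)}, mult = (\<circ>), one = id\<rparr>"

text \<open>A subgroup of the isometry group as a group in its own right. It acts on the space by
  evaluation, i.e. by \<^term>\<open>\<lambda>g. g\<close>.\<close>

abbreviation group_of_isometries :: "('a::metric_space \<Rightarrow> 'a) set \<Rightarrow> ('a \<Rightarrow> 'a) monoid" where
  "group_of_isometries \<Gamma> \<equiv> isometry_group\<lparr>carrier := \<Gamma>\<rparr>"

text \<open>The topology of \<open>E(d)\<close> is that of the semidirect product of \<open>R^d\<close> and \<open>O(d)\<close>, where \<open>O(d)\<close> is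
  a subspace of the space of matrices and the pair \<open>(a, A)\<close> stands for the map sending \<open>x\<close> to
  \<open>a + A x\<close>.\<close>

definition closed_in_isometry_group :: "(real^'n \<Rightarrow> real^'n) set \<Rightarrow> bool" where
  "closed_in_isometry_group \<Gamma> \<longleftrightarrow>
     closedin (top_of_set (UNIV \<times> {A. orthogonal_matrix A}))
       {(a :: real^'n, A :: real^'n^'n). orthogonal_matrix A \<and> (\<lambda>x. a + A *v x) \<in> \<Gamma>}"

lemma group_isometry_group: "group (isometry_group :: ('a::metric_space \<Rightarrow> 'a) monoid)"
proof (rule groupI)
  fix f :: "'a \<Rightarrow> 'a" assume f: "f \<in> carrier isometry_group"
  then have b: "bij f" and d: "\<And>x y. dist (f x) (f y) = dist x y"
    by (auto simp: isometry_group_def)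
  have "dist (inv_into UNIV f x) (inv_into UNIV f y) = dist x y" for x y
    using d[of "inv_into UNIV f x" "inv_into UNIV f y"] b by (simp add: bij_is_surj surj_f_inv_f)
  moreover have "inv_into UNIV f \<circ> f = id"
    using b by (auto simp: bij_is_inj)
  ultimately show "\<exists>g\<in>carrier isometry_group. g \<otimes>\<^bsub>isometry_group\<^esub> f = \<one>\<^bsub>isometry_group\<^esub>"
    using b by (intro bexI[of _ "inv_into UNIV f"]) (auto simp: isometry_group_def bij_imp_bij_inv)
qed (auto simp: isometry_group_def bij_comp)


section \<open>Abstract pattern spaces\<close>

record ('p, 'a) cutoff_space = "'p partial_object" +
  cut :: "'p \<Rightarrow> 'a set \<Rightarrow> 'p"  (infixl "\<curlywedge>\<index>" 70)

record ('p, 'a, 'g) pattern_space = "('p, 'a) cutoff_space" +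
  act :: "'g \<Rightarrow> 'p \<Rightarrow> 'p"

definition is_supp ::
    "('p, 'a::topological_space, 'm) cutoff_space_scheme \<Rightarrow> 'p \<Rightarrow> 'a set \<Rightarrow> bool" where
  "is_supp X P S \<longleftrightarrow> closed S \<and> (\<forall>C. closed C \<longrightarrow> (P \<curlywedge>\<^bsub>X\<^esub> C = P \<longleftrightarrow> S \<subseteq> C))"

definition supp :: "('p, 'a::topological_space, 'm) cutoff_space_scheme \<Rightarrow> 'p \<Rightarrow> 'a set" where
  "supp X P = (THE S. is_supp X P S)"

text \<open>The cutting-off operation is only specified on closed sets.\<close>

locale abstract_pattern_space =
  fixes X :: "('p, 'a::topological_space, 'm) cutoff_space_scheme" (structure)
  assumes nonempty: "carrier X \<noteq> {}"
    and cut_closed: "\<And>P C. P \<in> carrier X \<Longrightarrow> closed C \<Longrightarrow> P \<curlywedge> C \<in> carrier X"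
    and cut_cut: "\<And>P C D. P \<in> carrier X \<Longrightarrow> closed C \<Longrightarrow> closed D \<Longrightarrow> (P \<curlywedge> C) \<curlywedge> D = P \<curlywedge> (C \<inter> D)"
    and ex_supp: "\<And>P. P \<in> carrier X \<Longrightarrow> \<exists>S. is_supp X P S"

text \<open>\<open>\<phi>\<close> is the action of the group \<open>G\<close> on the underlying space. As usual for \<^const>\<open>group_action\<close>,
  the maps \<open>act X g\<close> are extensional, i.e. undefined outside of the carrier.\<close>

locale equivariant_pattern_space = abstract_pattern_space X
  for G :: "('g, 'k) monoid_scheme" and \<phi> :: "'g \<Rightarrow> 'a::topological_space \<Rightarrow> 'a"
    and X :: "('p, 'a, 'g, 'm) pattern_space_scheme" (structure) +
  assumes group_G: "group G"
    and action_space: "group_action G UNIV \<phi>"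
    and homeo_space: "\<And>g. g \<in> carrier G \<Longrightarrow> homeomorphic_map euclidean euclidean (\<phi> g)"
    and action_patterns: "group_action G (carrier X) (act X)"
    and equivariant: "\<And>g P C. g \<in> carrier G \<Longrightarrow> P \<in> carrier X \<Longrightarrow> closed C \<Longrightarrow>
                        act X g P \<curlywedge> (\<phi> g ` C) = act X g (P \<curlywedge> C)"

definition subshift ::
    "('g, 'k) monoid_scheme \<Rightarrow> ('p, 'a, 'g, 'm) pattern_space_scheme \<Rightarrow> 'p set \<Rightarrow> bool" where
  "subshift G X \<Sigma>' \<longleftrightarrow> \<Sigma>' \<noteq> {} \<and> \<Sigma>' \<subseteq> carrier X \<and> (\<forall>g\<in>carrier G. \<forall>P\<in>\<Sigma>'. act X g P \<in> \<Sigma>')"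

lemma (in abstract_pattern_space) is_supp_supp:
  assumes "P \<in> carrier X"
  shows "is_supp X P (supp X P)"
proof -
  obtain S where S: "is_supp X P S"
    using ex_supp assms by blast
  show ?thesis
    unfolding supp_def
  proof (rule theI[of _ S])
    show "T = S" if "is_supp X P T" for T
      using S that unfolding is_supp_def by blast
  qed (fact S)
qed


section \<open>Order and glueing\<close>

definition pattern_order ::
    "('p, 'a::topological_space, 'm) cutoff_space_scheme \<Rightarrow> 'p gorder" where
  "pattern_order X =
     \<lparr>carrier = carrier X, eq = (=), le = (\<lambda>Q P. P \<curlywedge>\<^bsub>X\<^esub> supp X Q = Q)\<rparr>"

lemma (in abstract_pattern_space) partial_order_pattern_order:
  "partial_order (pattern_order X)"
proof -
  have cl: "closed (supp X P)" if "P \<in> carrier X" for P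
    using is_supp_supp[OF that] by (simp add: is_supp_def)
  have cut_supp: "P \<curlywedge> C = P \<longleftrightarrow> supp X P \<subseteq> C" if "P \<in> carrier X" "closed C" for P C
    using is_supp_supp[OF that(1)] that(2) by (simp add: is_supp_def)
  have self: "P \<curlywedge> supp X P = P" if "P \<in> carrier X" for P
    using cut_supp[OF that cl[OF that]] by simp
  have anti: "P = Q"
    if P: "P \<in> carrier X" and Q: "Q \<in> carrier X"
      and QP: "Q \<curlywedge> supp X P = P" and PQ: "P \<curlywedge> supp X Q = Q" for P Q
  proof -
    have "Q = (Q \<curlywedge> supp X P) \<curlywedge> supp X Q"
      by (simp only: QP PQ)
    also have "\<dots> = (Q \<curlywedge> supp X Q) \<curlywedge> supp X P"
      by (simp only: cut_cut[OF Q cl[OF P] cl[OF Q]] cut_cut[OF Q cl[OF Q] cl[OF P]] Int_commute)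
    also have "\<dots> = P"
      by (simp only: self[OF Q] QP)
    finally show ?thesis ..
  qed
  have tr: "P \<curlywedge> supp X R = R"
    if P: "P \<in> carrier X" and Q: "Q \<in> carrier X" and R: "R \<in> carrier X"
      and PQ: "P \<curlywedge> supp X Q = Q" and QR: "Q \<curlywedge> supp X R = R" for P Q R
  proof -
    have "R \<curlywedge> supp X Q = (Q \<curlywedge> supp X R) \<curlywedge> supp X Q"
      by (simp only: QR)
    also have "\<dots> = (Q \<curlywedge> supp X Q) \<curlywedge> supp X R"
      by (simp only: cut_cut[OF Q cl[OF R] cl[OF Q]] cut_cut[OF Q cl[OF Q] cl[OF R]] Int_commute)
    also have "\<dots> = R"
      by (simp only: self[OF Q] QR)
    finally have sub: "supp X R \<subseteq> supp X Q"
      using cut_supp[OF R cl[OF Q]] by simp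
    have "P \<curlywedge> supp X R = (P \<curlywedge> supp X Q) \<curlywedge> supp X R"
      by (simp only: cut_cut[OF P cl[OF Q] cl[OF R]] Int_absorb1[OF sub])
    then show ?thesis
      by (simp only: PQ QR)
  qed
  show ?thesis
  proof (intro partial_order.intro weak_partial_order.intro equivalence.intro
               weak_partial_order_axioms.intro partial_order_axioms.intro)
    fix P Q
    assume "P \<in> carrier (pattern_order X)" "Q \<in> carrier (pattern_order X)"
      "P \<sqsubseteq>\<^bsub>pattern_order X\<^esub> Q" "Q \<sqsubseteq>\<^bsub>pattern_order X\<^esub> P"
    then show "P .=\<^bsub>pattern_order X\<^esub> Q"
      using anti by (simp add: pattern_order_def)
  next
    fix P Q R
    assume "P \<in> carrier (pattern_order X)" "Q \<in> carrier (pattern_order X)"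
      "R \<in> carrier (pattern_order X)"
      "P \<sqsubseteq>\<^bsub>pattern_order X\<^esub> Q" "Q \<sqsubseteq>\<^bsub>pattern_order X\<^esub> R"
    then show "P \<sqsubseteq>\<^bsub>pattern_order X\<^esub> R"
      using tr[of R Q P] by (simp add: pattern_order_def)
  qed (simp_all add: pattern_order_def self)
qed

definition is_supremum ::
    "('p, 'a::topological_space, 'm) cutoff_space_scheme \<Rightarrow> 'p set \<Rightarrow> 'p \<Rightarrow> bool" where
  "is_supremum X \<Xi> S \<longleftrightarrow> least (pattern_order X) S (Upper (pattern_order X) \<Xi>)"

definition cut_set ::
    "('p, 'a, 'm) cutoff_space_scheme \<Rightarrow> 'p set \<Rightarrow> 'a set \<Rightarrow> 'p set" where
  "cut_set X \<Xi> C = (\<lambda>P. P \<curlywedge>\<^bsub>X\<^esub> C) ` \<Xi>"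

definition compatible ::
    "('p, 'a::topological_space, 'm) cutoff_space_scheme \<Rightarrow> 'p \<Rightarrow> 'p \<Rightarrow> bool" where
  "compatible X P Q \<longleftrightarrow>
     (\<exists>R\<in>carrier X. P \<sqsubseteq>\<^bsub>pattern_order X\<^esub> R \<and> Q \<sqsubseteq>\<^bsub>pattern_order X\<^esub> R)"

definition pairwise_compatible ::
    "('p, 'a::topological_space, 'm) cutoff_space_scheme \<Rightarrow> 'p set \<Rightarrow> bool" where
  "pairwise_compatible X \<Xi> \<longleftrightarrow> (\<forall>P\<in>\<Xi>. \<forall>Q\<in>\<Xi>. compatible X P Q)"

definition locally_finite_patterns ::
    "('p, 'a::metric_space, 'm) cutoff_space_scheme \<Rightarrow> 'p set \<Rightarrow> bool" where
  "locally_finite_patterns X \<Xi> \<longleftrightarrow> (\<forall>x r. r > 0 \<longrightarrow> finite (cut_set X \<Xi> (cball x r)))"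

text \<open>That \<open>S \<curlywedge> C\<close> is the supremum of \<open>cut_set X \<Xi> C\<close> includes the existence of that supremum, which
  is unique because the order is antisymmetric.\<close>

definition glueable :: "('p, 'a::metric_space, 'm) cutoff_space_scheme \<Rightarrow> bool" where
  "glueable X \<longleftrightarrow>
     (\<forall>\<Xi>. \<Xi> \<subseteq> carrier X \<longrightarrow> locally_finite_patterns X \<Xi> \<longrightarrow> pairwise_compatible X \<Xi> \<longrightarrow>
        (\<exists>S. is_supremum X \<Xi> S \<and>
             (\<forall>C. closed C \<longrightarrow> is_supremum X (cut_set X \<Xi> C) (S \<curlywedge>\<^bsub>X\<^esub> C))))"

definition supremum_closed ::
    "('p, 'a::metric_space, 'm) cutoff_space_scheme \<Rightarrow> 'p set \<Rightarrow> bool" where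
  "supremum_closed X \<Sigma>' \<longleftrightarrow>
     (\<forall>\<Xi>. \<Xi> \<subseteq> \<Sigma>' \<longrightarrow> locally_finite_patterns X \<Xi> \<longrightarrow> pairwise_compatible X \<Xi> \<longrightarrow>
        (\<exists>S\<in>\<Sigma>'. is_supremum X \<Xi> S))"


section \<open>Building blocks and bounded components\<close>

definition building_block_family ::
    "('g, 'k) monoid_scheme \<Rightarrow> ('g \<Rightarrow> 'a \<Rightarrow> 'a::{metric_space, zero}) \<Rightarrow>
     ('p, 'a, 'g, 'm) pattern_space_scheme \<Rightarrow> 'p set \<Rightarrow> real \<Rightarrow> 'p set \<Rightarrow> bool" where
  "building_block_family G \<phi> X \<Sigma>' r F \<longleftrightarrow>
     F \<subseteq> \<Sigma>' \<and> F \<noteq> {} \<and> (\<forall>P\<in>F. supp X P \<noteq> {} \<and> supp X P \<subseteq> cball 0 r) \<and>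
     (\<forall>g\<in>carrier G. \<forall>h\<in>carrier G. \<forall>P\<in>F. \<forall>Q\<in>F.
        dist (\<phi> g 0) (\<phi> h 0) > 4 * r \<longrightarrow> compatible X (act X g P) (act X h Q)) \<and>
     (\<forall>P\<in>F. \<forall>Q\<in>F. \<forall>g\<in>carrier G. act X g P = Q \<longrightarrow> P = Q \<and> \<phi> g 0 = 0)"

definition building_block ::
    "('g, 'k) monoid_scheme \<Rightarrow> ('g \<Rightarrow> 'a \<Rightarrow> 'a::{metric_space, zero}) \<Rightarrow>
     ('p, 'a, 'g, 'm) pattern_space_scheme \<Rightarrow> 'p set \<Rightarrow> real \<Rightarrow> 'p \<Rightarrow> bool" where
  "building_block G \<phi> X \<Sigma>' r P \<longleftrightarrow> (\<exists>F. building_block_family G \<phi> X \<Sigma>' r F \<and> P \<in> F)"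

definition symmetric_building_block ::
    "('g, 'k) monoid_scheme \<Rightarrow> ('g \<Rightarrow> 'a \<Rightarrow> 'a::{metric_space, zero}) \<Rightarrow>
     ('p, 'a, 'g, 'm) pattern_space_scheme \<Rightarrow> 'p set \<Rightarrow> real \<Rightarrow> 'p \<Rightarrow> bool" where
  "symmetric_building_block G \<phi> X \<Sigma>' r P \<longleftrightarrow>
     building_block G \<phi> X \<Sigma>' r P \<and> stabilizer G (act X) P = stabilizer G \<phi> 0"

definition consists_of_bounded_components ::
    "('p, 'a::metric_space, 'm) cutoff_space_scheme \<Rightarrow> 'p \<Rightarrow> bool" where
  "consists_of_bounded_components X P \<longleftrightarrow>
     (\<exists>R>0. \<forall>C. closed C \<longrightarrow>
        (\<forall>x\<in>supp X (P \<curlywedge>\<^bsub>X\<^esub> C). x \<in> supp X (P \<curlywedge>\<^bsub>X\<^esub> C \<curlywedge>\<^bsub>X\<^esub> cball x R)))"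


section \<open>Local derivability\<close>

text \<open>\<open>locally_derivable G X P Y Q\<close>: the pattern \<open>Q\<close> of \<open>Y\<close> is locally derivable from the
  pattern \<open>P\<close> of \<open>X\<close>. The underlying metric spaces of \<open>X\<close> and \<open>Y\<close> may differ.\<close>

definition locally_derivable ::
    "('g, 'k) monoid_scheme \<Rightarrow> ('p, 'a::metric_space, 'g, 'm) pattern_space_scheme \<Rightarrow> 'p \<Rightarrow>
     ('q, 'b::metric_space, 'g, 'n) pattern_space_scheme \<Rightarrow> 'q \<Rightarrow> bool" where
  "locally_derivable G X P Y Q \<longleftrightarrow>
     (\<exists>x0 y0 R0. R0 \<ge> 0 \<and>
        (\<forall>g\<in>carrier G. \<forall>h\<in>carrier G. \<forall>R\<ge>0.
           act X g P \<curlywedge>\<^bsub>X\<^esub> cball x0 (R + R0) = act X h P \<curlywedge>\<^bsub>X\<^esub> cball x0 (R + R0) \<longrightarrow>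
           act Y g Q \<curlywedge>\<^bsub>Y\<^esub> cball y0 R = act Y h Q \<curlywedge>\<^bsub>Y\<^esub> cball y0 R))"

definition mutually_locally_derivable ::
    "('g, 'k) monoid_scheme \<Rightarrow> ('p, 'a::metric_space, 'g, 'm) pattern_space_scheme \<Rightarrow> 'p \<Rightarrow>
     ('q, 'b::metric_space, 'g, 'n) pattern_space_scheme \<Rightarrow> 'q \<Rightarrow> bool" where
  "mutually_locally_derivable G X P Y Q \<longleftrightarrow>
     locally_derivable G X P Y Q \<and> locally_derivable G Y Q X P"


section \<open>Delone sets\<close>

definition uniformly_discrete :: "'a::metric_space set \<Rightarrow> bool" where
  "uniformly_discrete D \<longleftrightarrow> (\<exists>r>0. \<forall>x\<in>D. \<forall>y\<in>D. x \<noteq> y \<longrightarrow> dist x y > r)"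

definition relatively_dense :: "'a::metric_space set \<Rightarrow> bool" where
  "relatively_dense D \<longleftrightarrow> (\<exists>R>0. \<forall>x. D \<inter> interior (cball x R) \<noteq> {})"

definition Delone :: "'a::metric_space set \<Rightarrow> bool" where
  "Delone D \<longleftrightarrow> uniformly_discrete D \<and> relatively_dense D"

definition UD :: "('g \<Rightarrow> 'a \<Rightarrow> 'a) \<Rightarrow> ('a::metric_space set, 'a, 'g) pattern_space" where
  "UD \<phi> = \<lparr>carrier = {D. uniformly_discrete D}, cut = (\<inter>),
           act = (\<lambda>g. \<lambda>D \<in> {D. uniformly_discrete D}. \<phi> g ` D)\<rparr>"

text \<open>The group is assumed to act by isometries, so that images of uniformly discrete sets are
  uniformly discrete.\<close>

lemma equivariant_pattern_space_UD:
  fixes \<phi> :: "'g \<Rightarrow> 'a::metric_space \<Rightarrow> 'a"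
  assumes G: "group G" and \<phi>: "group_action G UNIV \<phi>"
    and iso: "\<And>g x y. g \<in> carrier G \<Longrightarrow> dist (\<phi> g x) (\<phi> g y) = dist x y"
  shows "equivariant_pattern_space G \<phi> (UD \<phi>)"
proof -
  interpret \<phi>: group_action G UNIV \<phi> by (fact \<phi>)
  have mono: "uniformly_discrete (A :: 'a set)" if u: "uniformly_discrete B" and s: "A \<subseteq> B" for A B
  proof -
    obtain r where "r > 0" "\<forall>x\<in>B. \<forall>y\<in>B. x \<noteq> y \<longrightarrow> dist x y > r"
      using u unfolding uniformly_discrete_def by blast
    then show ?thesis
      unfolding uniformly_discrete_def using s by (intro exI[of _ r]) auto
  qed
  have cl: "closed D" if u: "uniformly_discrete D" for D :: "'a set"
  proof -
    obtain r where r: "r > 0" "\<forall>x\<in>D. \<forall>y\<in>D. x \<noteq> y \<longrightarrow> dist x y > r"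
      using u unfolding uniformly_discrete_def by blast
    have "y = x" if "x \<in> D" "y \<in> D" "dist y x < r" for x y
      using bspec[OF bspec[OF r(2) that(2)] that(1)] that(3) by linarith
    then show ?thesis
      using r(1) by (intro discrete_imp_closed[of r]) simp_all
  qed
  have ud: "uniformly_discrete (\<phi> g ` D)" if u: "uniformly_discrete D" and g: "g \<in> carrier G" for g D
  proof -
    obtain r where "r > 0" "\<forall>x\<in>D. \<forall>y\<in>D. x \<noteq> y \<longrightarrow> dist x y > r"
      using u unfolding uniformly_discrete_def by blast
    then show ?thesis
      unfolding uniformly_discrete_def using iso[OF g]
      by (intro exI[of _ r]) auto
  qed
  have inj: "inj (\<phi> g)" if "g \<in> carrier G" for g
    using \<phi>.inj_prop[OF that] .
  have comp: "\<phi> (g \<otimes>\<^bsub>G\<^esub> h) ` D = \<phi> g ` \<phi> h ` D" if "g \<in> carrier G" "h \<in> carrier G" for g h D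
    using \<phi>.composition_rule[of _ g h] that by (auto simp: image_image)
  have one: "\<phi> \<one>\<^bsub>G\<^esub> ` D = D" for D
    by (simp flip: \<phi>.id_eq_one)
  let ?E = "{D :: 'a set. uniformly_discrete D}"
  have bij: "act (UD \<phi>) g \<in> Bij ?E" if g: "g \<in> carrier G" for g
  proof -
    have i: "inv\<^bsub>G\<^esub> g \<in> carrier G" "inv\<^bsub>G\<^esub> g \<otimes>\<^bsub>G\<^esub> g = \<one>\<^bsub>G\<^esub>" "g \<otimes>\<^bsub>G\<^esub> inv\<^bsub>G\<^esub> g = \<one>\<^bsub>G\<^esub>"
      using G g by (simp_all add: group.l_inv group.r_inv group.inv_closed)
    have "bij_betw (\<lambda>D. \<phi> g ` D) ?E ?E"
    proof (rule bij_betwI[where g = "\<lambda>D. \<phi> (inv\<^bsub>G\<^esub> g) ` D"])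
      show "\<phi> (inv\<^bsub>G\<^esub> g) ` \<phi> g ` D = D" for D
        using comp[OF i(1) g, of D] one i(2) by simp
      show "\<phi> g ` \<phi> (inv\<^bsub>G\<^esub> g) ` D = D" for D
        using comp[OF g i(1), of D] one i(3) by simp
    qed (use ud g i(1) in auto)
    moreover have "bij_betw (act (UD \<phi>) g) ?E ?E \<longleftrightarrow> bij_betw (\<lambda>D. \<phi> g ` D) ?E ?E"
      by (rule bij_betw_cong) (simp add: UD_def)
    ultimately show ?thesis
      by (simp add: Bij_def) (simp add: UD_def extensional_def)
  qed
  have act_hom: "group_hom G (BijGroup ?E) (act (UD \<phi>))"
  proof (intro group_hom.intro group_hom_axioms.intro homI)
    fix g h assume gh: "g \<in> carrier G" "h \<in> carrier G"
    have "act (UD \<phi>) (g \<otimes>\<^bsub>G\<^esub> h) = compose ?E (act (UD \<phi>) g) (act (UD \<phi>) h)"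
      using gh ud comp by (auto simp: UD_def compose_def fun_eq_iff)
    then show "act (UD \<phi>) (g \<otimes>\<^bsub>G\<^esub> h) =
        act (UD \<phi>) g \<otimes>\<^bsub>BijGroup ?E\<^esub> act (UD \<phi>) h"
      using gh bij by (simp add: BijGroup_def)
  qed (use G bij group_BijGroup in \<open>auto simp: BijGroup_def\<close>)
  have homeo: "homeomorphic_map euclidean euclidean (\<phi> g)" if g: "g \<in> carrier G" for g
  proof -
    have cont: "continuous_on UNIV (\<phi> h)" if "h \<in> carrier G" for h
      unfolding continuous_on_iff using iso[OF that] by auto
    have i: "inv\<^bsub>G\<^esub> g \<in> carrier G"
      using G g by (simp add: group.inv_closed)
    have "\<phi> (inv\<^bsub>G\<^esub> g) (\<phi> g x) = x \<and> \<phi> g (\<phi> (inv\<^bsub>G\<^esub> g) x) = x" for x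
      using \<phi>.orbit_sym_aux[OF g, of x] \<phi>.orbit_sym_aux[OF i, of x] G g
      by (simp add: group.inv_inv)
    then have "homeomorphic_maps euclidean euclidean (\<phi> g) (\<phi> (inv\<^bsub>G\<^esub> g))"
      using cont[OF g] cont[OF i] by (simp add: homeomorphic_maps_def)
    then show ?thesis
      using homeomorphic_map_maps by blast
  qed
  have supp: "is_supp (UD \<phi>) D D" if "uniformly_discrete D" for D
    using cl[OF that] by (auto simp: is_supp_def UD_def)
  show ?thesis
  proof (intro equivariant_pattern_space.intro abstract_pattern_space.intro
               equivariant_pattern_space_axioms.intro)
    show "carrier (UD \<phi>) \<noteq> {}"
      by (auto simp: UD_def uniformly_discrete_def intro!: exI[of _ "{}"] exI[of _ 1])
    show "\<exists>S. is_supp (UD \<phi>) P S" if "P \<in> carrier (UD \<phi>)" for P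
      using supp that by (auto simp: UD_def)
    show "group_action G (carrier (UD \<phi>)) (act (UD \<phi>))"
      using act_hom by (simp add: UD_def group_action_def)
  next
    fix g P C assume "g \<in> carrier G" "P \<in> carrier (UD \<phi>)" "closed (C :: 'a set)"
    then show "act (UD \<phi>) g P \<curlywedge>\<^bsub>UD \<phi>\<^esub> (\<phi> g ` C) = act (UD \<phi>) g (P \<curlywedge>\<^bsub>UD \<phi>\<^esub> C)"
      using mono[of P "P \<inter> C"] by (simp add: UD_def image_Int inj)
  qed (use G \<phi> homeo in \<open>auto simp: UD_def Int_assoc intro: mono\<close>)
qed

definition Delone_deriving ::
    "('g, 'k) monoid_scheme \<Rightarrow> ('g \<Rightarrow> 'a \<Rightarrow> 'a::metric_space) \<Rightarrow>
     ('p, 'a, 'g, 'm) pattern_space_scheme \<Rightarrow> 'p \<Rightarrow> bool" where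
  "Delone_deriving G \<phi> X P \<longleftrightarrow> (\<exists>D. Delone D \<and> locally_derivable G X P (UD \<phi>) D)"

end

theory Submission
  imports Defs
begin

text \<open>The pattern \<open>P\<close> is first replaced by a set of points, the code, which carries the same local
  information; then a copy of a small symmetric building block is put at every point of the code.

  Let \<open>D\<close> be a Delone set derived from \<open>P\<close>, and call \<open>g\<close> a local symmetry at \<open>x\<close> if \<open>gP\<close> and \<open>P\<close>
  agree on a fixed large ball around \<open>x\<close>. Since \<open>P\<close> has bounded components, \<open>gP\<close> and \<open>P\<close> agree on a
  ball as soon as \<open>g\<close> is a local symmetry at the points of \<open>D\<close> in a slightly larger ball
  (\<open>agree_if_locally_agree\<close>). So a point set is mutually derivable with \<open>P\<close> if it is invariant under
  local symmetries, locally around each point (\<open>local_symmetry_imp_code_eq\<close>), and if conversely every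
  \<open>g\<close> that preserves it near some \<open>x \<in> D\<close> is a local symmetry at \<open>x\<close> (\<open>code_eq_imp_local_symmetry\<close>).

  The code consists of the points \<open>x\<close> of \<open>D\<close> and of satellites of \<open>x\<close>, one for each word \<open>W\<close> of
  \<open>DIM + 1\<close> points of \<open>D\<close> near \<open>x\<close>. The satellite lies in the direction of an expansion of \<open>W\<close>: a sum
  of the vectors \<open>w - x\<close> weighted with the powers of a small number, from which all letters can be
  read off (\<open>expansion_separated\<close>). Its distance from \<open>x\<close> is that of the expansion multiplied by
  \<open>\<delta>\<close> and by a factor close to 1, which depends only on the orbit of \<open>(x, W)\<close> under the local symmetries and
  is chosen such that the distance determines the orbit. This is possible although there may be
  infinitely many orbits, because there are only countably many (\<open>ex_scaling_separating_classes\<close>).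
  If \<open>g\<close> preserves the code near \<open>x\<close>, the satellite for a word whose letters span the space then shows
  that \<open>g\<close> coincides with a local symmetry. The points of \<open>D\<close> are recognised in the code as those
  which have no other point very close to them (\<open>mem_D_iff_isolated\<close>).

  As the building block has all the symmetries that fix the origin, its copies depend only on their
  positions and are permuted by the group like the points of the code (\<open>act_copy\<close>). The supremum
  of the copies is determined locally by the code (\<open>glues_cut_cong\<close>), and it shows where the points
  of the code are (\<open>glues_mem_iff\<close>).\<close>

section \<open>Groups of isometries\<close>

locale isometry_subgroup =
  fixes \<Gamma> :: "('a::metric_space \<Rightarrow> 'a) set"
  assumes subgroup_isometry_group: "subgroup \<Gamma> isometry_group"
begin

lemma bij_isometry: "bij g" if "g \<in> \<Gamma>"
  using subgroup.mem_carrier[OF subgroup_isometry_group that] by (simp add: isometry_group_def)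

lemma dist_isometry [simp]: "dist (g x) (g y) = dist x y" if "g \<in> \<Gamma>"
  using subgroup.mem_carrier[OF subgroup_isometry_group that] by (simp add: isometry_group_def)

lemma id_mem [simp]: "id \<in> \<Gamma>"
  using subgroup.one_closed[OF subgroup_isometry_group] by (simp add: isometry_group_def)

lemma comp_mem [simp]: "g \<circ> h \<in> \<Gamma>" if "g \<in> \<Gamma>" "h \<in> \<Gamma>"
  using subgroup.m_closed[OF subgroup_isometry_group that] by (simp add: isometry_group_def)

lemma inv_isometry_apply [simp]:
  assumes "g \<in> \<Gamma>"
  shows "inv_into UNIV g (g x) = x" "g (inv_into UNIV g x) = x"
  using bij_isometry[OF assms] by (simp_all add: bij_is_inj bij_is_surj surj_f_inv_f)

lemma inv_mem [simp]: "inv_into UNIV g \<in> \<Gamma>" if g: "g \<in> \<Gamma>"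
proof -
  interpret group "isometry_group :: ('a \<Rightarrow> 'a) monoid"
    by (rule group_isometry_group)
  have i: "inv\<^bsub>isometry_group\<^esub> g \<in> \<Gamma>"
    using subgroup.m_inv_closed[OF subgroup_isometry_group g] .
  have "g \<circ> inv\<^bsub>isometry_group\<^esub> g = id"
    using r_inv[OF subgroup.mem_carrier[OF subgroup_isometry_group g]]
    by (simp add: isometry_group_def)
  then have "g ((inv\<^bsub>isometry_group\<^esub> g) x) = x" for x
    by (metis comp_apply id_apply)
  then have "inv\<^bsub>isometry_group\<^esub> g = inv_into UNIV g"
    using inv_isometry_apply(1)[OF g] by (metis ext)
  then show ?thesis
    using i by simp
qed

lemma inv_comp [simp]: "inv_into UNIV g \<circ> g = id" "g \<circ> inv_into UNIV g = id" if "g \<in> \<Gamma>"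
  using that by (auto simp: fun_eq_iff)

lemma image_inv_image [simp]:
  "g ` inv_into UNIV g ` C = C" "inv_into UNIV g ` g ` C = C" if "g \<in> \<Gamma>"
  using that by (auto simp: image_image)

lemma image_cball_isometry [simp]: "g ` cball x r = cball (g x) r" if g: "g \<in> \<Gamma>"
proof
  show "g ` cball x r \<subseteq> cball (g x) r"
    using g by auto
  show "cball (g x) r \<subseteq> g ` cball x r"
  proof
    fix y assume "y \<in> cball (g x) r"
    then have "inv_into UNIV g y \<in> cball x r"
      using dist_isometry[OF g, of x "inv_into UNIV g y"] g by simp
    then show "y \<in> g ` cball x r"
      using inv_isometry_apply(2)[OF g, of y] by (metis image_eqI)
  qed
qed

lemma inj_isometry: "inj g" if "g \<in> \<Gamma>"
  using bij_isometry[OF that] by (rule bij_is_inj)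

lemma closed_image_isometry: "closed (g ` C)" if g: "g \<in> \<Gamma>" and "closed C"
proof -
  have "continuous_on UNIV (inv_into UNIV g)"
    unfolding continuous_on_iff using dist_isometry[OF inv_mem[OF g]] by auto
  moreover have "g ` C = inv_into UNIV g -` C"
    using g by (auto intro: image_eqI[of _ _ "inv_into UNIV g _"])
  ultimately show ?thesis
    using \<open>closed C\<close> by (simp add: closed_vimage)
qed

end


section \<open>Cutting off, supports and the order of patterns\<close>

context abstract_pattern_space
begin

abbreviation below :: "'p \<Rightarrow> 'p \<Rightarrow> bool"  (infix \<open>\<preceq>\<close> 50)
  where "below P Q \<equiv> Q \<curlywedge> supp X P = P"

lemma closed_supp: "closed (supp X P)" if "P \<in> carrier X"
  using is_supp_supp[OF that] by (simp add: is_supp_def)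

lemma cut_eq_iff: "P \<curlywedge> C = P \<longleftrightarrow> supp X P \<subseteq> C" if "P \<in> carrier X" "closed C"
  using is_supp_supp[OF that(1)] that(2) by (simp add: is_supp_def)

lemma cut_supp: "P \<curlywedge> supp X P = P" if "P \<in> carrier X"
  using cut_eq_iff[OF that closed_supp[OF that]] by simp

lemma cut_supp_Int: "P \<curlywedge> C = P \<curlywedge> (supp X P \<inter> C)" if "P \<in> carrier X" "closed C"
  using cut_cut[OF that(1) closed_supp[OF that(1)] that(2)] cut_supp[OF that(1)] by simp

lemma supp_cut_subset: "supp X (P \<curlywedge> C) \<subseteq> supp X P \<inter> C" if P: "P \<in> carrier X" and C: "closed C"
proof -
  have "P \<curlywedge> C \<curlywedge> (supp X P \<inter> C) = P \<curlywedge> (supp X P \<inter> C)"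
    using cut_cut[OF P C] closed_supp[OF P] C by (simp add: closed_Int Int_absorb1)
  then show ?thesis
    using cut_eq_iff[OF cut_closed[OF P C]] closed_supp[OF P] C cut_supp_Int[OF P C]
    by (simp add: closed_Int)
qed

lemma belowI: "P \<curlywedge> C = Q \<Longrightarrow> Q \<preceq> P" if P: "P \<in> carrier X" and C: "closed C"
  using supp_cut_subset[OF P C] cut_cut[OF P C closed_supp[OF cut_closed[OF P C]]]
    cut_supp[OF cut_closed[OF P C]] by (auto simp: Int_absorb1)

lemma supp_mono: "supp X P \<subseteq> supp X Q" if "P \<in> carrier X" "Q \<in> carrier X" "P \<preceq> Q"
  using supp_cut_subset[OF that(2) closed_supp[OF that(1)]] that(3) by auto

lemma below_refl: "P \<preceq> P" if "P \<in> carrier X"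
  using cut_supp[OF that] .

lemma cut_cong_subset:
  assumes "P \<in> carrier X" "Q \<in> carrier X" "closed C" "closed C'" "C' \<subseteq> C" "P \<curlywedge> C = Q \<curlywedge> C"
  shows "P \<curlywedge> C' = Q \<curlywedge> C'"
  using cut_cut[OF assms(1,3,4)] cut_cut[OF assms(2,3,4)] assms(5,6) by (simp add: Int_absorb1)

lemma is_supremum_iff:
  "is_supremum X \<Xi> S \<longleftrightarrow> S \<in> carrier X \<and> (\<forall>P\<in>\<Xi> \<inter> carrier X. P \<preceq> S) \<and>
     (\<forall>T\<in>carrier X. (\<forall>P\<in>\<Xi> \<inter> carrier X. P \<preceq> T) \<longrightarrow> S \<preceq> T)"
  unfolding is_supremum_def least_def Upper_def by (auto simp: pattern_order_def)

lemma below_antisym: "P = Q" if "P \<in> carrier X" "Q \<in> carrier X" "P \<preceq> Q" "Q \<preceq> P"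
proof -
  have "supp X P = supp X Q"
    using supp_mono that by blast
  then show ?thesis
    using that cut_supp by metis
qed

lemma is_supremum_unique: "is_supremum X \<Xi> S \<Longrightarrow> is_supremum X \<Xi> T \<Longrightarrow> S = T"
  unfolding is_supremum_iff by (blast intro: below_antisym)

lemma compatible_iff:
  "compatible X P Q \<longleftrightarrow> (\<exists>R\<in>carrier X. P \<preceq> R \<and> Q \<preceq> R)"
  by (simp add: compatible_def pattern_order_def)

lemma below_cut_empty: "P \<curlywedge> {} = Q \<curlywedge> {}"
  if "P \<in> carrier X" "Q \<in> carrier X" "P \<preceq> Q"
  using cut_cut[OF that(2) closed_supp[OF that(1)] closed_empty] that(3) by simp

text \<open>Parts with empty support can differ from pattern to pattern. For compatible patterns they are
  equal, being the part with empty support of any common upper bound.\<close>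

lemma compatible_cut_empty: "P \<curlywedge> {} = Q \<curlywedge> {}"
  if "P \<in> carrier X" "Q \<in> carrier X" "compatible X P Q"
  using that below_cut_empty unfolding compatible_iff by metis

lemma cut_disjoint: "P \<curlywedge> C = P \<curlywedge> {}" if "P \<in> carrier X" "closed C" "supp X P \<inter> C = {}"
  using cut_supp_Int[OF that(1,2)] that(3) by simp

end


section \<open>Patterns under isometries\<close>

locale isometric_pattern_space =
  isometry_subgroup \<Gamma> + equivariant_pattern_space "group_of_isometries \<Gamma>" "\<lambda>\<gamma>. \<gamma>" X
  for \<Gamma> :: "('a::heine_borel \<Rightarrow> 'a) set"
    and X :: "('p, 'a, 'a \<Rightarrow> 'a, 'm) pattern_space_scheme" (structure)
begin

lemma act_closed [simp]: "act X g P \<in> carrier X" if "g \<in> \<Gamma>" "P \<in> carrier X"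
  using group_action.element_image[OF action_patterns] that by simp

lemma act_comp: "act X (g \<circ> h) P = act X g (act X h P)"
  if "g \<in> \<Gamma>" "h \<in> \<Gamma>" "P \<in> carrier X"
  using group_action.composition_rule[OF action_patterns that(3), of g h] that(1,2)
  by (simp add: isometry_group_def)

lemma act_id [simp]: "act X id P = P" if "P \<in> carrier X"
  using fun_cong[OF group_action.id_eq_one[OF action_patterns], of P] that
  by (simp add: isometry_group_def)

lemma act_inv [simp]:
  assumes "g \<in> \<Gamma>" "P \<in> carrier X"
  shows "act X g (act X (inv_into UNIV g) P) = P" "act X (inv_into UNIV g) (act X g P) = P"
  using act_comp[of g "inv_into UNIV g" P] act_comp[of "inv_into UNIV g" g P] assms by simp_all

lemma act_cut: "act X g (P \<curlywedge> C) = act X g P \<curlywedge> (g ` C)"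
  if "g \<in> \<Gamma>" "P \<in> carrier X" "closed C"
  using equivariant[of g P C] that by simp

lemma supp_act: "supp X (act X g P) = g ` supp X P" if g: "g \<in> \<Gamma>" and P: "P \<in> carrier X"
proof -
  have sub: "supp X (act X g P) \<subseteq> g ` supp X P" if "g \<in> \<Gamma>" "P \<in> carrier X" for g P
    using act_cut[OF that closed_supp[OF that(2)]] cut_supp[OF that(2)]
      cut_eq_iff[OF act_closed[OF that] closed_image_isometry[OF that(1) closed_supp[OF that(2)]]]
    by simp
  have "supp X P \<subseteq> inv_into UNIV g ` supp X (act X g P)"
    using sub[OF inv_mem[OF g] act_closed[OF g P]] g P by simp
  then have "g ` supp X P \<subseteq> g ` inv_into UNIV g ` supp X (act X g P)"
    by (rule image_mono)
  then show ?thesis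
    using sub[OF g P] g by simp
qed

lemma act_below: "act X g P \<preceq> act X g Q"
  if "g \<in> \<Gamma>" "P \<in> carrier X" "Q \<in> carrier X" "P \<preceq> Q"
  using act_cut[OF that(1,3) closed_supp[OF that(2)]] supp_act[OF that(1,2)] that(4) by simp

lemma is_supremum_act:
  assumes g: "g \<in> \<Gamma>" and \<Xi>: "\<Xi> \<subseteq> carrier X" and S: "is_supremum X \<Xi> S"
  shows "is_supremum X (act X g ` \<Xi>) (act X g S)"
  unfolding is_supremum_iff
proof (intro conjI ballI impI)
  note S = S[unfolded is_supremum_iff]
  show "act X g S \<in> carrier X"
    using S g by simp
  show "P \<preceq> act X g S" if "P \<in> act X g ` \<Xi> \<inter> carrier X" for P
    using that S g \<Xi> act_below by blast
  fix T assume T: "T \<in> carrier X" and up: "\<forall>P\<in>act X g ` \<Xi> \<inter> carrier X. P \<preceq> T"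
  let ?T = "act X (inv_into UNIV g) T"
  have T': "?T \<in> carrier X"
    using g T by simp
  have "P \<preceq> ?T" if "P \<in> \<Xi>" for P
    using act_below[OF inv_mem[OF g], of "act X g P" T] up that \<Xi> T g by force
  then have "S \<preceq> ?T"
    using S T' by blast
  then show "act X g S \<preceq> T"
    using act_below[OF g _ T'] S T g by force
qed

text \<open>All comparisons below are between \<open>\<gamma>P\<close> and \<open>P\<close> on a ball, so that local derivability
  becomes a statement about one isometry at a time.\<close>

definition agree :: "'p \<Rightarrow> ('a \<Rightarrow> 'a) \<Rightarrow> 'a \<Rightarrow> real \<Rightarrow> bool" where
  "agree P g z R \<longleftrightarrow> act X g P \<curlywedge> cball z R = P \<curlywedge> cball z R"

lemma agree_subset: "agree P g x L"
  if "agree P g z R" "g \<in> \<Gamma>" "P \<in> carrier X" "cball x L \<subseteq> cball z R"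
  using cut_cong_subset[OF act_closed[OF that(2,3)] that(3) _ _ that(4)] that(1)
  by (simp add: agree_def)

lemma agree_id: "agree P id z R" if "P \<in> carrier X"
  using that by (simp add: agree_def)

lemma agree_inv: "agree P (inv_into UNIV g) (inv_into UNIV g z) R"
  if "agree P g z R" and g: "g \<in> \<Gamma>" and P: "P \<in> carrier X"
proof -
  have "act X (inv_into UNIV g) (act X g P \<curlywedge> cball z R) = act X (inv_into UNIV g) (P \<curlywedge> cball z R)"
    using that(1) by (simp add: agree_def)
  then show ?thesis
    using g P by (simp add: agree_def act_cut)
qed

lemma agree_comp: "agree P (g \<circ> h) (g z) R"
  if "agree P h z R" "agree P g (g z) R" and g: "g \<in> \<Gamma>" and h: "h \<in> \<Gamma>" and P: "P \<in> carrier X"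
proof -
  have "act X g (act X h P \<curlywedge> cball z R) = act X g (P \<curlywedge> cball z R)"
    using that(1) by (simp add: agree_def)
  then show ?thesis
    using that(2) g h P by (simp add: agree_def act_cut act_comp)
qed

end


section \<open>Isometries of a Euclidean space and expansions with digits in a finite set\<close>

locale euclidean_isometry_subgroup = isometry_subgroup \<Gamma>
  for \<Gamma> :: "('a::euclidean_space \<Rightarrow> 'a) set"
begin

lemma linear_part: "linear (\<lambda>v. g v - g 0)" if "g \<in> \<Gamma>"
proof -
  have "orthogonal_transformation (\<lambda>v. g v - g 0)"
    unfolding orthogonal_transformation_isometry using dist_isometry[OF that]
    by (simp add: dist_norm)
  then show ?thesis
    by (rule orthogonal_transformation_linear)
qed

lemma isometry_add: "g (x + v) = g x + (g v - g 0)" if "g \<in> \<Gamma>"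
  using linear_add[OF linear_part[OF that], of x v] by (simp add: algebra_simps)

end

text \<open>The zeros \<open>t b + u b\<close> lie far out near the coordinate axes. The errors \<open>u b\<close> are bounded
  independently of \<open>t\<close>, so for large \<open>t\<close> the sum of the norms of the \<open>F b\<close> is at most a multiple of
  itself with a factor below 1.\<close>

lemma linear_vanishing_near_axes_eq_0:
  fixes F :: "'a::euclidean_space \<Rightarrow> 'b::real_normed_vector" and t R :: real
  assumes F: "linear F" and zero: "\<And>b. b \<in> Basis \<Longrightarrow> F (t *\<^sub>R b + u b) = 0"
    and u: "\<And>b. b \<in> Basis \<Longrightarrow> norm (u b) \<le> R" and t: "DIM('a) * R < t"
  shows "F x = 0"
proof -
  let ?s = "\<Sum>b\<in>Basis. norm (F b)"
  have le: "t * norm (F b) \<le> R * ?s" if b: "b \<in> Basis" for b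
  proof -
    have "t *\<^sub>R F b = - F (u b)"
      using zero[OF b] by (simp add: linear_add[OF F] linear_scale[OF F] eq_neg_iff_add_eq_0)
    then have "t * norm (F b) \<le> norm (F (u b))"
      by (metis abs_ge_self mult_right_mono norm_ge_zero norm_minus_cancel norm_scaleR)
    also have "F (u b) = F (\<Sum>c\<in>Basis. (u b \<bullet> c) *\<^sub>R c)"
      by (simp add: euclidean_representation)
    also have "\<dots> = (\<Sum>c\<in>Basis. (u b \<bullet> c) *\<^sub>R F c)"
      by (simp add: linear_sum[OF F] linear_scale[OF F])
    also have "norm \<dots> \<le> (\<Sum>c\<in>Basis. R * norm (F c))"
    proof (rule sum_norm_le)
      fix c :: 'a assume "c \<in> Basis"
      then have "\<bar>u b \<bullet> c\<bar> \<le> R"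
        using Basis_le_norm[of c "u b"] u[OF b] by linarith
      then show "norm ((u b \<bullet> c) *\<^sub>R F c) \<le> R * norm (F c)"
        by (simp add: mult_right_mono)
    qed
    finally show ?thesis
      by (simp add: sum_distrib_left)
  qed
  have "t * ?s \<le> DIM('a) * (R * ?s)"
    using sum_mono[of Basis "\<lambda>b. t * norm (F b)" "\<lambda>b. R * ?s"] le by (simp add: sum_distrib_left)
  then have "(t - DIM('a) * R) * ?s \<le> 0"
    by (simp add: algebra_simps)
  then have "?s \<le> 0"
    using t by (simp add: mult_le_0_iff)
  moreover have "?s \<ge> 0"
    by (simp add: sum_nonneg)
  ultimately have "?s = 0"
    by linarith
  then have "F b = 0" if "b \<in> Basis" for b
    using that by (simp add: sum_nonneg_eq_0_iff)
  then have "(\<Sum>c\<in>Basis. (x \<bullet> c) *\<^sub>R F c) = 0"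
    by simp
  moreover have "F x = (\<Sum>c\<in>Basis. (x \<bullet> c) *\<^sub>R F c)"
    by (subst euclidean_representation[symmetric])
       (simp only: linear_sum[OF F] linear_scale[OF F])
  ultimately show ?thesis
    by simp
qed

text \<open>The letters of the word are the digits, relative to \<open>x\<close>, of an expansion in powers of \<open>\<mu>\<close>.\<close>

fun expansion :: "real \<Rightarrow> 'a::real_normed_vector \<Rightarrow> 'a list \<Rightarrow> 'a" where
  "expansion \<mu> x [] = 0"
| "expansion \<mu> x (w # ws) = (w - x) + \<mu> *\<^sub>R expansion \<mu> x ws"

lemma expansion_append:
  "expansion \<mu> x (V @ W) = expansion \<mu> x V + \<mu> ^ length V *\<^sub>R expansion \<mu> x W"
  by (induction V) (simp_all add: algebra_simps)

lemma (in euclidean_isometry_subgroup) isometry_expansion: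
  assumes g: "g \<in> \<Gamma>"
  shows "g (x + c *\<^sub>R expansion \<mu> x W) = g x + c *\<^sub>R expansion \<mu> (g x) (map g W)"
proof -
  note L = linear_part[OF g]
  have "g (expansion \<mu> x W) - g 0 = expansion \<mu> (g x) (map g W)"
  proof (induction W)
    case (Cons w W)
    show ?case
      using linear_add[OF L, of "w - x" "\<mu> *\<^sub>R expansion \<mu> x W"] linear_diff[OF L, of w x]
        linear_scale[OF L, of \<mu> "expansion \<mu> x W"] Cons.IH by simp
  qed simp
  then show ?thesis
    using isometry_add[OF g, of x "c *\<^sub>R expansion \<mu> x W"]
      linear_scale[OF L, of c "expansion \<mu> x W"] by simp
qed

lemma (in euclidean_isometry_subgroup) norm_expansion_isometry:
  assumes g: "g \<in> \<Gamma>"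
  shows "norm (expansion \<mu> (g x) (map g W)) = norm (expansion \<mu> x W)"
  using isometry_expansion[OF g, of x 1 \<mu> W] dist_isometry[OF g, of "x + expansion \<mu> x W" x]
  by (simp add: dist_norm)

lemma norm_expansion_le:
  assumes "0 \<le> \<mu>" "\<mu> \<le> 1/2" "0 \<le> l" "set W \<subseteq> cball x l"
  shows "norm (expansion \<mu> x W) \<le> 2 * l"
  using assms(4)
proof (induction W)
  case (Cons w W)
  have "norm (expansion \<mu> x (w # W)) \<le> norm (w - x) + \<mu> * norm (expansion \<mu> x W)"
    using assms(1) norm_triangle_ineq[of "w - x" "\<mu> *\<^sub>R expansion \<mu> x W"] by simp
  also have "\<dots> \<le> l + 1/2 * (2 * l)"
    using Cons assms by (intro add_mono mult_mono) (auto simp: dist_norm norm_minus_commute)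
  finally show ?case
    by simp
qed (use assms in simp)

lemma norm_expansion_ge:
  assumes "0 \<le> \<mu>" "\<mu> \<le> 1/2" "0 \<le> l" "set W \<subseteq> cball x l" "W \<noteq> []"
  shows "norm (expansion \<mu> x W) \<ge> dist (hd W) x - 2 * \<mu> * l"
proof (cases W)
  case (Cons w V)
  have "norm (\<mu> *\<^sub>R expansion \<mu> x V) \<le> \<mu> * (2 * l)"
    using norm_expansion_le[of \<mu> l V x] assms Cons by (simp add: mult_left_mono)
  moreover have "norm (w - x) \<le> norm (expansion \<mu> x W) + norm (\<mu> *\<^sub>R expansion \<mu> x V)"
    using norm_triangle_ineq4[of "expansion \<mu> x W" "\<mu> *\<^sub>R expansion \<mu> x V"] Cons by simp
  ultimately show ?thesis
    using Cons by (simp add: dist_norm)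
qed (use assms in simp)

text \<open>The first digit in which two words differ changes the expansion by at least \<open>r\<close> times the
  weight of that digit, and all later digits together cannot make up for half of this.\<close>

lemma expansion_separated:
  assumes \<mu>: "0 < \<mu>" "\<mu> \<le> 1/2" and l: "0 \<le> l" and r: "8 * \<mu> * l \<le> r"
    and sep: "\<And>v w. v \<in> D \<Longrightarrow> w \<in> D \<Longrightarrow> v \<noteq> w \<Longrightarrow> r \<le> dist v w"
    and "set V \<subseteq> D \<inter> cball x l" "set W \<subseteq> D \<inter> cball x l" "length V = Suc k" "length W = Suc k"
    and "V \<noteq> W"
  shows "\<mu> ^ k * (r / 2) \<le> norm (expansion \<mu> x V - expansion \<mu> x W)"
  using assms(6-)
proof (induction k arbitrary: V W)
  case 0
  obtain v w where "V = [v]" "W = [w]"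
    using 0(3,4) by (auto simp: length_Suc_conv)
  moreover have "0 \<le> 8 * \<mu> * l"
    using \<mu> l by simp
  ultimately show ?case
    using 0 sep[of v w] r by (simp add: dist_norm)
next
  case (Suc k)
  obtain v V' w W' where VW: "V = v # V'" "W = w # W'" "length V' = Suc k" "length W' = Suc k"
    using Suc.prems(3,4) unfolding length_Suc_conv[of _ "Suc k"] by blast
  have r0: "0 \<le> r"
    using \<mu> l r by (metis mult_nonneg_nonneg order_less_imp_le order_trans zero_le_numeral)
  let ?d = "expansion \<mu> x V' - expansion \<mu> x W'"
  have eq: "expansion \<mu> x V - expansion \<mu> x W = (v - w) + \<mu> *\<^sub>R ?d"
    using VW by (simp add: algebra_simps)
  show ?case
  proof (cases "v = w")
    case True
    then have "\<mu> ^ k * (r / 2) \<le> norm ?d"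
      using Suc.IH[of V' W'] Suc.prems VW by auto
    then have "\<mu> * (\<mu> ^ k * (r / 2)) \<le> \<mu> * norm ?d"
      using \<mu> by simp
    then show ?thesis
      unfolding eq using True \<mu> by simp
  next
    case False
    have "norm (expansion \<mu> x V') \<le> 2 * l" "norm (expansion \<mu> x W') \<le> 2 * l"
      using norm_expansion_le[of \<mu> l _ x] Suc.prems VW \<mu> l by auto
    then have "norm ?d \<le> 4 * l"
      using norm_triangle_ineq4[of "expansion \<mu> x V'" "expansion \<mu> x W'"] by linarith
    then have "norm (\<mu> *\<^sub>R ?d) \<le> \<mu> * (4 * l)"
      using \<mu> by simp
    moreover have "r \<le> norm (v - w)"
      using sep[of v w] False Suc.prems VW by (simp add: dist_norm)
    moreover have "norm (v - w) \<le> norm ((v - w) + \<mu> *\<^sub>R ?d) + norm (\<mu> *\<^sub>R ?d)"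
      using norm_triangle_ineq4[of "(v - w) + \<mu> *\<^sub>R ?d" "\<mu> *\<^sub>R ?d"] by simp
    ultimately have "r / 2 \<le> norm ((v - w) + \<mu> *\<^sub>R ?d)"
      using r by linarith
    moreover have "\<mu> ^ Suc k * (r / 2) \<le> 1 * (r / 2)"
      using \<mu> r0 by (intro mult_right_mono power_le_one) auto
    ultimately show ?thesis
      unfolding eq by linarith
  qed
qed

text \<open>The values \<open>s i * a i\<close> are chosen one after the other: each has to avoid only finitely many
  earlier ones and can be taken from a whole interval.\<close>

lemma ex_scaling_separating_classes:
  fixes a :: "'i \<Rightarrow> real"
  assumes I: "countable I" and E: "equiv I E" and pos: "\<And>i. i \<in> I \<Longrightarrow> 0 < a i"
    and inv: "\<And>i j. (i, j) \<in> E \<Longrightarrow> a i = a j" and \<epsilon>: "0 < \<epsilon>"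
  shows "\<exists>s. (\<forall>i\<in>I. 1 \<le> s i \<and> s i \<le> 1 + \<epsilon>) \<and>
             (\<forall>i\<in>I. \<forall>j\<in>I. s i * a i = s j * a j \<longleftrightarrow> (i, j) \<in> E)"
proof -
  define n where "n i = to_nat_on (I // E) (E `` {i})" for i
  have "I // E = (\<lambda>i. E `` {i}) ` I"
    by (auto simp: quotient_def)
  then have cq: "countable (I // E)"
    using I by simp
  have n: "n i = n j \<longleftrightarrow> (i, j) \<in> E" if "i \<in> I" "j \<in> I" for i j
    using inj_on_eq_iff[OF inj_on_to_nat_on[OF cq], of "E `` {i}" "E `` {j}"]
      eq_equiv_class_iff[OF E that] that by (simp add: n_def quotientI)
  define b where "b k = a (SOME i. i \<in> I \<and> n i = k)" for k
  have b: "b (n i) = a i" if i: "i \<in> I" for i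
  proof -
    have "(SOME j. j \<in> I \<and> n j = n i) \<in> I \<and> n (SOME j. j \<in> I \<and> n j = n i) = n i"
      by (rule someI[of _ i]) (use i in simp)
    then show ?thesis
      unfolding b_def using n[of "SOME j. j \<in> I \<and> n j = n i" i] i inv by blast
  qed
  have "\<exists>v. \<forall>k. (0 < b k \<longrightarrow> v k \<in> {b k .. (1 + \<epsilon>) * b k}) \<and> v k \<notin> v ` {..<k}"
  proof (rule dependent_wellorder_choice[where
        P = "\<lambda>v k y. (0 < b k \<longrightarrow> y \<in> {b k .. (1 + \<epsilon>) * b k}) \<and> y \<notin> v ` {..<k}"])
    fix v :: "nat \<Rightarrow> real" and k :: nat
    show "\<exists>y. (0 < b k \<longrightarrow> y \<in> {b k .. (1 + \<epsilon>) * b k}) \<and> y \<notin> v ` {..<k}"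
    proof (cases "0 < b k")
      case True
      then have "infinite {b k .. (1 + \<epsilon>) * b k}"
        using \<epsilon> by (simp add: infinite_Icc_iff algebra_simps)
      then obtain y where "y \<in> {b k .. (1 + \<epsilon>) * b k}" "y \<notin> v ` {..<k}"
        by (meson finite_imageI finite_lessThan finite_subset subsetI)
      then show ?thesis
        by blast
    next
      case False
      then show ?thesis
        using ex_new_if_finite[OF infinite_UNIV_char_0, of "v ` {..<k}"] by blast
    qed
  qed (metis (no_types, lifting) image_cong lessThan_iff)
  then obtain v where v: "\<And>k. 0 < b k \<Longrightarrow> b k \<le> v k \<and> v k \<le> (1 + \<epsilon>) * b k"
    and new: "\<And>j k. j < k \<Longrightarrow> v j \<noteq> v k"
    by (metis atLeastAtMost_iff image_eqI lessThan_iff)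
  have inj: "v j = v k \<longleftrightarrow> j = k" for j k
    using new[of j k] new[of k j] by (metis nat_neq_iff)
  show ?thesis
  proof (intro exI[of _ "\<lambda>i. v (n i) / a i"] conjI ballI)
    fix i assume i: "i \<in> I"
    show "1 \<le> v (n i) / a i" "v (n i) / a i \<le> 1 + \<epsilon>"
      using v[of "n i"] b[OF i] pos[OF i] by (simp_all add: field_simps)
    fix j assume j: "j \<in> I"
    show "v (n i) / a i * a i = v (n j) / a j * a j \<longleftrightarrow> (i, j) \<in> E"
      using pos[OF i] pos[OF j] inj n[OF i j] by simp
  qed
qed

lemma uniform_discrete_imp_countable:
  fixes D :: "'a::euclidean_space set"
  assumes "uniform_discrete D"
  shows "countable D"
proof -
  have "finite (D \<inter> cball 0 (real n))" for n
    using assms uniform_discrete_finite_iff[of "D \<inter> cball 0 (real n)"] uniform_discrete_subset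
    by (meson Int_lower1 bounded_Int bounded_cball)
  moreover have "D = (\<Union>n. D \<inter> cball 0 (real n))"
    using real_arch_simple by (auto simp: dist_norm)
  ultimately show ?thesis
    by (metis countable_UN countable_finite countableI_type)
qed


section \<open>Coding a pattern into the points of a Delone set\<close>

text \<open>\<open>A g x\<close> stands for the fact that \<open>g\<close> moves the part of a pattern near \<open>g\<inverse> x\<close> to its part near
  \<open>x\<close>. The pairs with this property form a groupoid that acts on \<open>D\<close>. The radius \<open>l\<close>
  is large enough for the points of \<open>D\<close> within distance \<open>l\<close> of \<open>x\<close>, taken relative to \<open>x\<close>, to contain
  a good approximation of a multiple of the basis.\<close>

locale local_symmetries = euclidean_isometry_subgroup \<Gamma>
  for \<Gamma> :: "('a::euclidean_space \<Rightarrow> 'a) set" +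
  fixes D :: "'a set" and r d l :: real and A :: "('a \<Rightarrow> 'a) \<Rightarrow> 'a \<Rightarrow> bool"
  assumes r_pos: "0 < r" and r_le: "r \<le> d"
    and l_def: "l = (DIM('a) + 2) * d"
    and D_separated: "\<And>x y. x \<in> D \<Longrightarrow> y \<in> D \<Longrightarrow> x \<noteq> y \<Longrightarrow> r \<le> dist x y"
    and D_dense: "\<And>z. \<exists>x\<in>D. dist z x \<le> d"
    and A_id: "\<And>x. A id x"
    and A_inv: "\<And>g x. g \<in> \<Gamma> \<Longrightarrow> A g x \<Longrightarrow> A (inv_into UNIV g) (inv_into UNIV g x)"
    and A_comp: "\<And>g h x. g \<in> \<Gamma> \<Longrightarrow> h \<in> \<Gamma> \<Longrightarrow> A h x \<Longrightarrow> A g (g x) \<Longrightarrow> A (g \<circ> h) (g x)"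
    and A_imp_D: "\<And>g x. g \<in> \<Gamma> \<Longrightarrow> A g x \<Longrightarrow> g ` D \<inter> cball x l = D \<inter> cball x l"
begin

text \<open>Digits are at most \<open>l\<close> long and \<open>r\<close> apart, so \<open>\<mu>\<close> is of the order of \<open>r/l\<close>; \<open>\<delta>\<close> keeps the satellites
  of \<open>x\<close> within \<open>r/8\<close> of \<open>x\<close>; and \<open>\<epsilon>\<close> makes the variation of the scaling factors harmless compared
  with a change of the last digit, whose weight is \<open>\<mu>\<close> to the power \<open>DIM\<close>.\<close>

definition \<mu> :: real where "\<mu> = r / (16 * l)"
definition \<delta> :: real where "\<delta> = r / (32 * l)"
definition \<epsilon> :: real where "\<epsilon> = \<mu> ^ DIM('a) * r / (64 * l)"

abbreviation offset :: "'a \<Rightarrow> 'a list \<Rightarrow> 'a" where "offset \<equiv> expansion \<mu>"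

text \<open>\<open>DIM\<close> letters and \<open>x\<close> can determine an isometry by their images. The last letter can be varied without
  moving the satellite far, which distinguishes satellites from points of \<open>D\<close>. The first letter differs
  from \<open>x\<close> to keep the offset away from zero.\<close>

definition words :: "'a \<Rightarrow> 'a list set" where
  "words x = {W. length W = Suc DIM('a) \<and> set W \<subseteq> D \<inter> cball x l \<and> hd W \<noteq> x}"

definition same_type :: "(('a \<times> 'a list) \<times> ('a \<times> 'a list)) set" where
  "same_type = {((x, V), (y, W)). x \<in> D \<and> V \<in> words x \<and> y \<in> D \<and> W \<in> words y \<and>
     (\<exists>g\<in>\<Gamma>. A g y \<and> g x = y \<and> map g V = W)}"

text \<open>The factors depend only on the type of \<open>(x, W)\<close>, since so does the norm of the offset; and the
  scaled norm determines the type.\<close>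

definition is_scaling :: "('a \<times> 'a list \<Rightarrow> real) \<Rightarrow> bool" where
  "is_scaling s \<longleftrightarrow> (\<forall>i\<in>Sigma D words. 1 \<le> s i \<and> s i \<le> 1 + \<epsilon>) \<and>
     (\<forall>i\<in>Sigma D words. \<forall>j\<in>Sigma D words.
        s i * norm (offset (fst i) (snd i)) = s j * norm (offset (fst j) (snd j)) \<longleftrightarrow>
        (i, j) \<in> same_type)"

definition \<sigma> :: "'a \<times> 'a list \<Rightarrow> real" where "\<sigma> = (SOME s. is_scaling s)"

definition satellite :: "'a \<Rightarrow> 'a list \<Rightarrow> 'a" where
  "satellite x W = x + (\<delta> * \<sigma> (x, W)) *\<^sub>R offset x W"

definition code :: "'a set" where
  "code = D \<union> (\<Union>x\<in>D. satellite x ` words x)"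

lemma d_pos: "0 < d" and l_pos: "0 < l" and r_le_l: "3 * r \<le> l"
proof -
  show d: "0 < d"
    using r_pos r_le by simp
  have "1 \<le> real DIM('a)"
    by simp
  then have "3 * d \<le> (real DIM('a) + 2) * d"
    using d by (intro mult_right_mono) auto
  then have "3 * d \<le> l"
    by (simp add: l_def add.commute)
  then show "0 < l" "3 * r \<le> l"
    using d r_le by linarith+
qed

lemma \<mu>_pos: "0 < \<mu>" and \<mu>_le: "\<mu> \<le> 1/2" and \<mu>_l: "16 * \<mu> * l = r"
  using r_pos l_pos r_le_l by (simp_all add: \<mu>_def field_simps)

lemma \<delta>_pos: "0 < \<delta>" and \<delta>_l: "32 * \<delta> * l = r" and \<delta>_le: "\<delta> \<le> 1"
  using r_pos l_pos r_le_l by (simp_all add: \<delta>_def field_simps)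

lemma \<epsilon>_pos: "0 < \<epsilon>" and \<epsilon>_l: "64 * \<epsilon> * l = \<mu> ^ DIM('a) * r" and \<epsilon>_le: "\<epsilon> \<le> 1"
proof -
  show "0 < \<epsilon>" and e: "64 * \<epsilon> * l = \<mu> ^ DIM('a) * r"
    using r_pos l_pos \<mu>_pos by (simp_all add: \<epsilon>_def)
  have "\<mu> ^ DIM('a) * r \<le> 1 * r"
    using \<mu>_pos \<mu>_le r_pos by (intro mult_right_mono power_le_one) auto
  then have "64 * \<epsilon> * l \<le> 64 * 1 * l"
    using e r_le_l l_pos r_pos by linarith
  then show "\<epsilon> \<le> 1"
    using l_pos by (simp add: mult_le_cancel_right)
qed

lemma \<mu>_power_le: "\<mu> ^ DIM('a) \<le> \<mu>"
  using power_decreasing[of 1 "DIM('a)" \<mu>] \<mu>_pos \<mu>_le by (simp add: Suc_leI)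

lemma norm_offset_le: "norm (offset x W) \<le> 2 * l" if "W \<in> words x"
  using norm_expansion_le[of \<mu> l W x] that \<mu>_pos \<mu>_le l_pos by (auto simp: words_def)

lemma norm_offset_ge: "r / 2 \<le> norm (offset x W)" if "x \<in> D" "W \<in> words x"
proof -
  have W: "W \<noteq> []" "set W \<subseteq> D \<inter> cball x l" "hd W \<noteq> x"
    using that(2) by (auto simp: words_def)
  then have "hd W \<in> D"
    using hd_in_set by blast
  then have "r \<le> dist (hd W) x"
    using D_separated[of "hd W" x] W that(1) by simp
  moreover have "dist (hd W) x - 2 * \<mu> * l \<le> norm (offset x W)"
    using norm_expansion_ge[of \<mu> l W x] W \<mu>_pos \<mu>_le l_pos by auto
  ultimately show ?thesis
    using \<mu>_l r_pos by linarith
qed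

lemma offset_separated: "\<mu> ^ DIM('a) * (r / 2) \<le> norm (offset x V - offset x W)"
  if "V \<in> words x" "W \<in> words x" "V \<noteq> W"
  using that expansion_separated[of \<mu> l r D V x W "DIM('a)"] D_separated \<mu>_pos \<mu>_le \<mu>_l l_pos r_pos
  by (simp add: words_def)

lemma words_subset_lists: "words x \<subseteq> lists D"
  by (auto simp: words_def)

lemma D_uniform_discrete: "uniform_discrete D"
  using r_pos D_separated unfolding uniform_discrete_def by (meson not_le)

text \<open>A local symmetry near \<open>g x\<close> respects the whole construction around \<open>x\<close>: the points of \<open>D\<close>, the
  words, and finally the satellites.\<close>

lemma words_isometry:
  assumes g: "g \<in> \<Gamma>" and A: "A g (g x)" and W: "W \<in> words x"
  shows "map g W \<in> words (g x)"
proof -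
  have "g ` set W \<subseteq> g ` (D \<inter> cball x l)"
    using W by (intro image_mono) (simp add: words_def)
  also have "\<dots> \<subseteq> g ` D \<inter> cball (g x) l"
    using g by auto
  finally have "g ` set W \<subseteq> D \<inter> cball (g x) l"
    using A_imp_D[OF g A] by simp
  moreover have "hd (map g W) \<noteq> g x"
    using W inj_isometry[OF g] by (cases W) (auto simp: words_def inj_def)
  ultimately show ?thesis
    using W by (simp add: words_def)
qed

lemma mem_D_isometry: "g x \<in> D \<longleftrightarrow> x \<in> D" if g: "g \<in> \<Gamma>" and A: "A g (g x)"
proof -
  have "g x \<in> D \<longleftrightarrow> g x \<in> g ` D"
    using A_imp_D[OF g A] l_pos by (metis IntD1 IntI centre_in_cball less_imp_le)
  also have "\<dots> \<longleftrightarrow> x \<in> D"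
    using inj_isometry[OF g] by (simp add: inj_image_mem_iff)
  finally show ?thesis .
qed

lemma equiv_same_type: "equiv (Sigma D words) same_type"
proof (rule equivI)
  show "same_type \<subseteq> Sigma D words \<times> Sigma D words"
    by (auto simp: same_type_def)
  show "refl_on (Sigma D words) same_type"
    by (auto simp: refl_on_def same_type_def intro!: bexI[of _ id] A_id)
  show "sym same_type"
  proof (rule symI)
    fix i j assume ij: "(i, j) \<in> same_type"
    obtain x V y W where i: "i = (x, V)" and j: "j = (y, W)"
      by (meson surj_pair)
    obtain g where g: "g \<in> \<Gamma>" "A g y" "g x = y" "map g V = W"
      using ij by (auto simp: same_type_def i j)
    have "inv_into UNIV g y = x" "map (inv_into UNIV g) W = V"
      using g by (auto simp: comp_def)
    moreover have "A (inv_into UNIV g) x"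
      using A_inv[OF g(1,2)] g by auto
    ultimately show "(j, i) \<in> same_type"
      using ij inv_mem[OF g(1)] by (auto simp: same_type_def i j)
  qed
  show "trans same_type"
  proof (rule transI)
    fix i j k assume ij: "(i, j) \<in> same_type" and jk: "(j, k) \<in> same_type"
    obtain x U y V z W where i: "i = (x, U)" and j: "j = (y, V)" and k: "k = (z, W)"
      by (meson surj_pair)
    obtain g where g: "g \<in> \<Gamma>" "A g y" "g x = y" "map g U = V"
      using ij by (auto simp: same_type_def i j)
    obtain h where h: "h \<in> \<Gamma>" "A h z" "h y = z" "map h V = W"
      using jk by (auto simp: same_type_def j k)
    have "A (h \<circ> g) z"
      using A_comp[OF h(1) g(1,2)] h by simp
    moreover have "h \<circ> g \<in> \<Gamma>" "(h \<circ> g) x = z" "map (h \<circ> g) U = W"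
      using g h by auto
    ultimately show "(i, k) \<in> same_type"
      using ij jk by (auto simp: same_type_def i j k simp del: comp_apply)
  qed
qed

lemma is_scaling_\<sigma>: "is_scaling \<sigma>"
proof -
  have cD: "countable D"
    using D_uniform_discrete by (rule uniform_discrete_imp_countable)
  then have c: "countable (Sigma D words)"
    using countable_subset[OF words_subset_lists countable_lists[OF cD]]
    by (intro countable_SIGMA) auto
  have pos: "0 < norm (offset (fst i) (snd i))" if "i \<in> Sigma D words" for i
    using norm_offset_ge[of "fst i" "snd i"] r_pos that by auto
  have inv: "norm (offset (fst i) (snd i)) = norm (offset (fst j) (snd j))"
    if "(i, j) \<in> same_type" for i j
    using that norm_expansion_isometry by (auto simp: same_type_def)
  have "\<exists>s. is_scaling s"
    unfolding is_scaling_def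
    by (rule ex_scaling_separating_classes[OF c equiv_same_type pos inv \<epsilon>_pos])
  then show ?thesis
    unfolding \<sigma>_def by (rule someI_ex)
qed

lemma \<sigma>_bounds: "1 \<le> \<sigma> (x, W)" "\<sigma> (x, W) \<le> 1 + \<epsilon>" if "x \<in> D" "W \<in> words x"
  using is_scaling_\<sigma> that by (auto simp: is_scaling_def)

lemma \<sigma>_separates: "\<sigma> (x, V) * norm (offset x V) = \<sigma> (y, W) * norm (offset y W) \<longleftrightarrow>
    ((x, V), (y, W)) \<in> same_type"
  if "x \<in> D" "V \<in> words x" "y \<in> D" "W \<in> words y"
proof -
  have i: "(x, V) \<in> Sigma D words" "(y, W) \<in> Sigma D words"
    using that by auto
  show ?thesis
    using bspec[OF bspec[OF conjunct2[OF is_scaling_\<sigma>[unfolded is_scaling_def]] i(1)] i(2)]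
    unfolding fst_conv snd_conv .
qed

lemma \<sigma>_same_type: "\<sigma> (x, V) = \<sigma> (y, W)" if st: "((x, V), (y, W)) \<in> same_type"
proof -
  have xy: "x \<in> D" "V \<in> words x" "y \<in> D" "W \<in> words y"
    using st by (simp_all add: same_type_def)
  obtain g where "g \<in> \<Gamma>" "g x = y" "map g V = W"
    using st unfolding same_type_def by blast
  then have "norm (offset y W) = norm (offset x V)"
    using norm_expansion_isometry by blast
  moreover have "norm (offset x V) > 0"
    using norm_offset_ge[OF xy(1,2)] r_pos by linarith
  ultimately show ?thesis
    using iffD2[OF \<sigma>_separates[OF xy] st] by simp
qed

lemma satellite_isometry:
  assumes g: "g \<in> \<Gamma>" and A: "A g (g x)" and x: "x \<in> D" and W: "W \<in> words x"
  shows "g (satellite x W) = satellite (g x) (map g W)"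
proof -
  have "((x, W), (g x, map g W)) \<in> same_type"
    using words_isometry[OF g A W] mem_D_isometry[OF g A] assms by (auto simp: same_type_def)
  then have "\<sigma> (x, W) = \<sigma> (g x, map g W)"
    by (rule \<sigma>_same_type)
  then show ?thesis
    by (simp add: satellite_def isometry_expansion[OF g])
qed

lemma \<sigma>_offset_near: "norm (\<sigma> (x, W) *\<^sub>R offset x W - offset x W) \<le> 2 * \<epsilon> * l"
  if "x \<in> D" "W \<in> words x"
proof -
  have "norm (\<sigma> (x, W) *\<^sub>R offset x W - offset x W) = (\<sigma> (x, W) - 1) * norm (offset x W)"
    using \<sigma>_bounds(1)[OF that] norm_scaleR[of "\<sigma> (x, W) - 1" "offset x W"]
    by (simp add: scaleR_diff_left)
  also have "\<dots> \<le> \<epsilon> * (2 * l)"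
    using \<sigma>_bounds[OF that] norm_offset_le[OF that(2)] by (intro mult_mono) auto
  finally show ?thesis
    by (simp add: mult_ac)
qed

lemma dist_satellite: "dist x (satellite x W) = \<delta> * \<sigma> (x, W) * norm (offset x W)"
  if "x \<in> D" "W \<in> words x"
  using \<delta>_pos \<sigma>_bounds(1)[OF that] by (simp add: satellite_def dist_norm)

lemma dist_satellite_bounds:
  assumes "x \<in> D" "W \<in> words x"
  shows "\<delta> * (r / 2) \<le> dist x (satellite x W)" "dist x (satellite x W) \<le> r / 8"
proof -
  have "\<delta> * (1 * (r / 2)) \<le> \<delta> * (\<sigma> (x, W) * norm (offset x W))"
    using \<delta>_pos \<sigma>_bounds(1)[OF assms] norm_offset_ge[OF assms] r_pos
    by (intro mult_left_mono mult_mono) auto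
  then show "\<delta> * (r / 2) \<le> dist x (satellite x W)"
    by (simp add: dist_satellite[OF assms] mult_ac)
  have "\<delta> * (\<sigma> (x, W) * norm (offset x W)) \<le> \<delta> * (2 * (2 * l))"
    using \<delta>_pos \<sigma>_bounds[OF assms] norm_offset_le[OF assms(2)] \<epsilon>_le
    by (intro mult_left_mono mult_mono) auto
  then show "dist x (satellite x W) \<le> r / 8"
    using \<delta>_l by (simp add: dist_satellite[OF assms] mult_ac)
qed

text \<open>Different words have offsets at distance at least \<open>\<mu> ^ DIM * r / 2\<close>, and by the choice of
  \<open>\<epsilon>\<close> the scaling factors cannot use up more than half of this.\<close>

lemma satellites_separated:
  assumes x: "x \<in> D" and V: "V \<in> words x" and W: "W \<in> words x" and ne: "V \<noteq> W"
  shows "\<delta> * \<mu> ^ DIM('a) * (r / 4) \<le> dist (satellite x V) (satellite x W)"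
proof -
  let ?v = "\<sigma> (x, V) *\<^sub>R offset x V" and ?w = "\<sigma> (x, W) *\<^sub>R offset x W"
  have "\<mu> ^ DIM('a) * (r / 2) \<le> norm (offset x V - offset x W)"
    using offset_separated[OF V W ne] .
  also have "\<dots> = norm ((?v - ?w) - ((?v - offset x V) - (?w - offset x W)))"
    by (simp add: algebra_simps)
  also have "\<dots> \<le> norm (?v - ?w) + (norm (?v - offset x V) + norm (?w - offset x W))"
    by (intro order_trans[OF norm_triangle_ineq4] add_left_mono norm_triangle_ineq4)
  finally have "\<mu> ^ DIM('a) * (r / 2) \<le> norm (?v - ?w) + 4 * \<epsilon> * l"
    using \<sigma>_offset_near[OF x V] \<sigma>_offset_near[OF x W] by linarith
  moreover have "0 < \<mu> ^ DIM('a) * r"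
    using \<mu>_pos r_pos by simp
  ultimately have "\<mu> ^ DIM('a) * (r / 4) \<le> norm (?v - ?w)"
    using \<epsilon>_l by linarith
  then have "\<delta> * (\<mu> ^ DIM('a) * (r / 4)) \<le> \<delta> * norm (?v - ?w)"
    using \<delta>_pos by simp
  also have "\<delta> * norm (?v - ?w) = norm (\<delta> *\<^sub>R (?v - ?w))"
    using \<delta>_pos by simp
  also have "\<delta> *\<^sub>R (?v - ?w) = satellite x V - satellite x W"
    by (simp add: satellite_def algebra_simps)
  finally show ?thesis
    by (simp add: dist_norm mult_ac)
qed

text \<open>Such a \<open>V\<close> arises from \<open>W\<close> by a change of the last letter. The first letter and \<open>x\<close> are two different
  choices for this letter, so one of them is a change.\<close>

lemma ex_near_satellite:
  assumes x: "x \<in> D" and W: "W \<in> words x"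
  shows "\<exists>V\<in>words x. satellite x V \<noteq> satellite x W \<and>
           dist (satellite x V) (satellite x W) \<le> \<delta> * (r / 4)"
proof -
  obtain U w where U: "W = U @ [w]" "length U = DIM('a)"
    using W by (auto simp: words_def length_Suc_conv_rev)
  then obtain u U' where U': "U = u # U'"
    by (metis DIM_positive length_0_conv less_irrefl neq_Nil_conv)
  define v where "v = (if w = x then u else x)"
  have u: "u \<in> D \<inter> cball x l" "u \<noteq> x"
    using W U U' by (auto simp: words_def)
  have v: "v \<noteq> w" "v \<in> D \<inter> cball x l"
    using u x l_pos by (auto simp: v_def)
  define V where "V = U @ [v]"
  have V: "V \<in> words x"
    using W U U' v by (auto simp: words_def V_def)
  have ne: "V \<noteq> W"
    using v U by (simp add: V_def)
  let ?v = "\<sigma> (x, V) *\<^sub>R offset x V" and ?w = "\<sigma> (x, W) *\<^sub>R offset x W"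
  have "offset x V - offset x W = \<mu> ^ DIM('a) *\<^sub>R (v - w)"
    by (simp add: V_def U expansion_append flip: scaleR_diff_right)
  then have "norm (offset x V - offset x W) = \<mu> ^ DIM('a) * dist v w"
    using \<mu>_pos by (simp add: dist_norm)
  also have "\<dots> \<le> \<mu> * (2 * l)"
  proof (rule mult_mono)
    have "w \<in> cball x l"
      using W U by (auto simp: words_def)
    then show "dist v w \<le> 2 * l"
      using v dist_triangle3[of v w x] by auto
  qed (use \<mu>_power_le \<mu>_pos in auto)
  finally have off: "norm (offset x V - offset x W) \<le> r / 8"
    using \<mu>_l by simp
  have "norm (?v - ?w) = norm ((offset x V - offset x W) + ((?v - offset x V) - (?w - offset x W)))"
    by (simp add: algebra_simps)
  also have "\<dots> \<le> norm (offset x V - offset x W) + (norm (?v - offset x V) + norm (?w - offset x W))"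
    by (intro order_trans[OF norm_triangle_ineq] add_left_mono norm_triangle_ineq4)
  finally have "norm (?v - ?w) \<le> r / 8 + 4 * \<epsilon> * l"
    using \<sigma>_offset_near[OF x V] \<sigma>_offset_near[OF x W] off by linarith
  moreover have "\<mu> ^ DIM('a) * r \<le> 1 * r"
    using \<mu>_power_le \<mu>_le r_pos by (intro mult_right_mono) auto
  ultimately have "norm (?v - ?w) \<le> r / 4"
    using \<epsilon>_l r_pos by linarith
  then have "\<delta> * norm (?v - ?w) \<le> \<delta> * (r / 4)"
    using \<delta>_pos by simp
  moreover have "\<delta> * norm (?v - ?w) = norm (\<delta> *\<^sub>R (?v - ?w))"
    using \<delta>_pos by simp
  moreover have "\<delta> *\<^sub>R (?v - ?w) = satellite x V - satellite x W"
    by (simp add: satellite_def algebra_simps)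
  ultimately have "dist (satellite x V) (satellite x W) \<le> \<delta> * (r / 4)"
    by (simp add: dist_norm)
  moreover have "0 < \<delta> * \<mu> ^ DIM('a) * (r / 4)"
    using \<delta>_pos \<mu>_pos r_pos by simp
  then have "satellite x V \<noteq> satellite x W"
    using satellites_separated[OF x V W ne] by auto
  ultimately show ?thesis
    using V by blast
qed

lemma codeE:
  assumes "e \<in> code"
  obtains x where "x \<in> D" "dist x e \<le> r / 8" "e = x \<or> (\<exists>W\<in>words x. e = satellite x W)"
  using assms dist_satellite_bounds(2) r_pos unfolding code_def by (force simp: less_imp_le)

lemma code_separated:
  assumes e: "e \<in> code" and f: "f \<in> code" and ne: "e \<noteq> f"
  shows "\<delta> * \<mu> ^ DIM('a) * (r / 4) \<le> dist e f"
proof -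
  obtain x where x: "x \<in> D" "dist x e \<le> r / 8" "e = x \<or> (\<exists>W\<in>words x. e = satellite x W)"
    using codeE[OF e] .
  obtain y where y: "y \<in> D" "dist y f \<le> r / 8" "f = y \<or> (\<exists>W\<in>words y. f = satellite y W)"
    using codeE[OF f] .
  have p1: "\<mu> ^ DIM('a) \<le> 1"
    using \<mu>_power_le \<mu>_le by linarith
  have "\<delta> * \<mu> ^ DIM('a) * (r / 4) \<le> \<delta> * 1 * (r / 2)"
    using \<delta>_pos \<mu>_pos p1 r_pos by (intro mult_mono) auto
  then have c1: "\<delta> * \<mu> ^ DIM('a) * (r / 4) \<le> \<delta> * (r / 2)"
    by simp
  have "\<delta> * (r / 2) \<le> 1 * (r / 2)"
    using \<delta>_le r_pos by (intro mult_right_mono) auto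
  then have c2: "\<delta> * (r / 2) \<le> r / 2"
    by simp
  show ?thesis
  proof (cases "x = y")
    case False
    then have "r \<le> dist x y"
      using D_separated x y by blast
    moreover have "dist x y \<le> dist x e + dist e f + dist y f"
      using dist_triangle[of x y e] dist_triangle[of e y f] by (simp add: dist_commute)
    ultimately show ?thesis
      using x y c1 c2 r_pos by linarith
  next
    case True
    then consider "e = x" "\<exists>W\<in>words x. f = satellite x W" | "f = x" "\<exists>W\<in>words x. e = satellite x W"
      | V W where "V \<in> words x" "W \<in> words x" "e = satellite x V" "f = satellite x W"
      using x y ne by blast
    then show ?thesis
    proof cases
      case 1
      then obtain W where W: "W \<in> words x" "f = satellite x W"
        by blast
      then show ?thesis
        using order_trans[OF c1 dist_satellite_bounds(1)[OF x(1) W(1)]] 1(1) by simp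
    next
      case 2
      then obtain W where W: "W \<in> words x" "e = satellite x W"
        by blast
      then show ?thesis
        using order_trans[OF c1 dist_satellite_bounds(1)[OF x(1) W(1)]] 2(1)
        by (simp add: dist_commute)
    next
      case 3
      then have "V \<noteq> W"
        using ne by blast
      then show ?thesis
        using satellites_separated[OF x(1)] 3 by blast
    qed
  qed
qed

text \<open>A satellite has another satellite of the same centre within \<open>\<delta> * r / 4\<close>, whereas a centre is at
  distance at least \<open>\<delta> * r / 2\<close> from its own satellites, and even further from everything else.\<close>

lemma mem_D_iff_isolated:
  assumes e: "e \<in> code"
  shows "e \<in> D \<longleftrightarrow> (\<forall>f\<in>code. f \<noteq> e \<longrightarrow> \<delta> * (r / 4) < dist f e)"
proof
  assume eD: "e \<in> D"
  show "\<forall>f\<in>code. f \<noteq> e \<longrightarrow> \<delta> * (r / 4) < dist f e"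
  proof (intro ballI impI)
    fix f assume "f \<in> code" "f \<noteq> e"
    then obtain y where y: "y \<in> D" "dist y f \<le> r / 8" "f = y \<or> (\<exists>W\<in>words y. f = satellite y W)"
      using codeE by blast
    have "0 < \<delta> * r"
      using \<delta>_pos r_pos by simp
    have "\<delta> * r \<le> 1 * r"
      using \<delta>_le r_pos by (intro mult_right_mono) auto
    show "\<delta> * (r / 4) < dist f e"
    proof (cases "y = e")
      case True
      then have "\<delta> * (r / 2) \<le> dist e f"
        using y \<open>f \<noteq> e\<close> dist_satellite_bounds(1)[OF eD] by auto
      then show ?thesis
        using \<open>0 < \<delta> * r\<close> by (simp add: dist_commute)
    next
      case False
      then have "r \<le> dist y e"
        using D_separated y eD by blast
      also have "\<dots> \<le> dist y f + dist f e"
        by (rule dist_triangle)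
      finally show ?thesis
        using y \<open>\<delta> * r \<le> 1 * r\<close> r_pos by linarith
    qed
  qed
next
  assume iso: "\<forall>f\<in>code. f \<noteq> e \<longrightarrow> \<delta> * (r / 4) < dist f e"
  show "e \<in> D"
  proof (rule ccontr)
    assume "e \<notin> D"
    then obtain x W where "x \<in> D" "W \<in> words x" "e = satellite x W"
      using e by (auto simp: code_def)
    then obtain V where V: "V \<in> words x" "satellite x V \<noteq> e" "dist (satellite x V) e \<le> \<delta> * (r / 4)"
      using ex_near_satellite by blast
    then have "satellite x V \<in> code"
      using \<open>x \<in> D\<close> by (auto simp: code_def)
    then show False
      using iso V by force
  qed
qed

lemma satellite_cases:
  assumes e: "e \<in> code" and x: "x \<in> D" and ex: "dist x e \<le> r / 8" "e \<noteq> x"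
  shows "\<exists>W\<in>words x. e = satellite x W"
proof -
  obtain y where y: "y \<in> D" "dist y e \<le> r / 8" "e = y \<or> (\<exists>W\<in>words y. e = satellite y W)"
    using codeE[OF e] .
  have "dist x y \<le> r / 4"
    using dist_triangle2[of x y e] ex y by linarith
  then have "x = y"
    using D_separated[OF x y(1)] r_pos by force
  then show ?thesis
    using y ex by blast
qed

text \<open>A point of the code in the ball has its centre in the slightly larger ball, where \<open>g\<close> is a local
  symmetry. The other inclusion is the same statement for the inverse of \<open>g\<close>.\<close>

lemma local_symmetry_imp_code_eq:
  assumes g: "g \<in> \<Gamma>" and A: "\<And>y. y \<in> cball z (R + r) \<Longrightarrow> A g y"
  shows "g ` code \<inter> cball z R = code \<inter> cball z R"
proof -
  have sub: "g ` code \<inter> cball z R \<subseteq> code" if g: "g \<in> \<Gamma>" and A: "\<And>y. y \<in> cball z (R + r) \<Longrightarrow> A g y"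
    for g z
  proof
    fix p assume "p \<in> g ` code \<inter> cball z R"
    then obtain e where e: "e \<in> code" "p = g e" "dist z p \<le> R"
      by auto
    then obtain x where x: "x \<in> D" "dist x e \<le> r / 8" "e = x \<or> (\<exists>W\<in>words x. e = satellite x W)"
      using codeE by blast
    have "dist z (g x) \<le> R + r"
      using dist_triangle[of z "g x" p] e x g r_pos dist_isometry[OF g, of x e]
      by (simp add: dist_commute)
    then have Ax: "A g (g x)"
      using A by simp
    then have "g x \<in> D"
      using mem_D_isometry[OF g] x by blast
    moreover have "satellite x W \<in> code \<longrightarrow> g (satellite x W) \<in> code" if "W \<in> words x" for W
      using satellite_isometry[OF g Ax x(1) that] words_isometry[OF g Ax that] \<open>g x \<in> D\<close>
      by (auto simp: code_def)
    ultimately show "p \<in> code"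
      using x e by (auto simp: code_def)
  qed
  have "inv_into UNIV g ` code \<inter> cball (inv_into UNIV g z) R \<subseteq> code"
  proof (rule sub[OF inv_mem[OF g]])
    fix y assume y: "y \<in> cball (inv_into UNIV g z) (R + r)"
    then have "dist z (g y) \<le> R + r"
      using g dist_isometry[OF g, of "inv_into UNIV g z" y] by simp
    then show "A (inv_into UNIV g) y"
      using A_inv[OF g A[of "g y"]] g by simp
  qed
  then have "g ` (inv_into UNIV g ` code \<inter> cball (inv_into UNIV g z) R) \<subseteq> g ` code"
    by (rule image_mono)
  then have "code \<inter> cball z R \<subseteq> g ` code"
    using g by (simp add: image_Int[OF inj_isometry[OF g]])
  then show ?thesis
    using sub[OF g A] by blast
qed

text \<open>The letters other than the last are points of \<open>D\<close> close to \<open>x + t b\<close>, where \<open>b\<close> runs through the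
  basis and \<open>t\<close> is large compared with the distance by which they may miss this point. Isometries that
  agree on \<open>x\<close> and on these points are equal.\<close>

lemma ex_spanning_word:
  assumes x: "x \<in> D"
  shows "\<exists>W\<in>words x. \<forall>g\<in>\<Gamma>. \<forall>h\<in>\<Gamma>. g x = h x \<longrightarrow> map g W = map h W \<longrightarrow> g = h"
proof -
  define t where "t = (DIM('a) + 1) * d"
  have t: "0 < t" "DIM('a) * d < t" "d < t"
  proof -
    show "0 < t"
      unfolding t_def using d_pos by (intro mult_pos_pos) auto
    show "DIM('a) * d < t" "d < t"
      using d_pos by (simp_all add: t_def algebra_simps)
  qed
  have "\<forall>b. \<exists>y. y \<in> D \<and> dist (x + t *\<^sub>R b) y \<le> d"
    using D_dense by blast
  then obtain v where v: "\<And>b. v b \<in> D" "\<And>b. dist (x + t *\<^sub>R b) (v b) \<le> d"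
    by metis
  obtain bs :: "'a list" where bs: "set bs = Basis" "distinct bs"
    using finite_distinct_list[OF finite_Basis] by blast
  then have len: "length bs = DIM('a)"
    by (metis distinct_card)
  define W where "W = map v bs @ [x]"
  have near: "dist x (v b) \<le> l" "v b \<noteq> x" if b: "b \<in> Basis" for b
  proof -
    have tb: "dist x (x + t *\<^sub>R b) = t"
      using b t by (simp add: dist_norm)
    have "l = t + d"
      by (simp add: t_def l_def algebra_simps)
    then show "dist x (v b) \<le> l"
      using dist_triangle[of x "v b" "x + t *\<^sub>R b"] tb v(2)[of b] by linarith
    show "v b \<noteq> x"
      using tb v(2)[of b] t by (auto simp: dist_commute)
  qed
  have "bs \<noteq> []"
    using len by auto
  then have "hd W = v (hd bs)" "hd bs \<in> Basis"
    using bs hd_in_set[of bs] by (simp_all add: W_def hd_append hd_map)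
  then have "W \<in> words x"
    using near v(1) x len bs l_pos by (auto simp: words_def W_def)
  moreover have "g = h" if g: "g \<in> \<Gamma>" and h: "h \<in> \<Gamma>" and "g x = h x" "map g W = map h W" for g h
  proof -
    let ?F = "\<lambda>u. (g u - g 0) - (h u - h 0)"
    have lin: "linear ?F"
      using linear_compose_sub[OF linear_part[OF g] linear_part[OF h]] .
    have diff: "?F (y - x) = (g y - g x) - (h y - h x)" for y
      using linear_diff[OF linear_part[OF g], of y x] linear_diff[OF linear_part[OF h], of y x]
      by simp
    have "?F u = 0" for u
    proof (rule linear_vanishing_near_axes_eq_0[OF lin])
      fix b :: 'a assume b: "b \<in> Basis"
      have "g (v b) = h (v b)"
        using that(4) b bs by (simp add: W_def)
      then show "?F (t *\<^sub>R b + (v b - (x + t *\<^sub>R b))) = 0"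
        using diff[of "v b"] \<open>g x = h x\<close> by simp
      show "norm (v b - (x + t *\<^sub>R b)) \<le> d"
        using v(2)[of b] by (simp add: dist_norm norm_minus_commute)
    qed (use t in simp)
    then have "g y = h y" for y
      using diff[of y] \<open>g x = h x\<close> by simp
    then show ?thesis
      by blast
  qed
  ultimately show ?thesis
    by blast
qed

text \<open>The satellite of \<open>x\<close> for a spanning word \<open>W\<close> also belongs to the image of the code, hence is the
  image under \<open>g\<close> of a satellite for some word \<open>V\<close>. Its distance from the centre reveals that the
  two words have the same type, so the scaling factors are equal, so the offsets are, so \<open>g\<close> maps \<open>V\<close>
  to \<open>W\<close>. But some local symmetry \<open>h\<close> does so, too, and \<open>W\<close> determines the isometry.\<close>

lemma code_eq_imp_local_symmetry:
  assumes g: "g \<in> \<Gamma>" and x: "x \<in> D"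
    and eq: "g ` code \<inter> cball x (2 * l) = code \<inter> cball x (2 * l)"
  shows "A g x"
proof -
  have \<delta>r: "0 < \<delta> * r" "\<delta> * r \<le> r"
    using \<delta>_pos r_pos mult_right_mono[OF \<delta>_le, of r] by simp_all
  have code_iff: "p \<in> g ` code \<longleftrightarrow> p \<in> code" if "dist x p \<le> 2 * l" for p
  proof -
    have "p \<in> cball x (2 * l)"
      using that by simp
    then show ?thesis
      using eq by blast
  qed
  \<comment> \<open>Being isolated is decided by the code near \<open>p\<close>, which is the same for both codes.\<close>
  have D_sub: "p \<in> g ` D \<longleftrightarrow> p \<in> D" if p: "dist x p \<le> l" for p
  proof -
    define q where "q = inv_into UNIV g p"
    have p': "p = g q"
      using g by (simp add: q_def)
    have near: "f \<in> g ` code \<longleftrightarrow> f \<in> code" if "dist f p \<le> \<delta> * (r / 4)" for f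
    proof (rule code_iff)
      have "dist x f \<le> l + \<delta> * (r / 4)"
        using dist_triangle[of x f p] p that by (simp add: dist_commute)
      then show "dist x f \<le> 2 * l"
        using \<delta>r r_le_l r_pos by linarith
    qed
    have pc: "p \<in> code \<longleftrightarrow> q \<in> code"
      using near[of p] \<delta>r by (simp add: p' inj_image_mem_iff[OF inj_isometry[OF g]])
    have "p \<in> g ` D \<longleftrightarrow> q \<in> D"
      by (simp add: p' inj_image_mem_iff[OF inj_isometry[OF g]])
    moreover have "(\<forall>f\<in>code. f \<noteq> q \<longrightarrow> \<delta> * (r / 4) < dist f q) \<longleftrightarrow>
        (\<forall>f\<in>g ` code. f \<noteq> p \<longrightarrow> \<delta> * (r / 4) < dist f p)"
      using inj_isometry[OF g] by (auto simp: p' g inj_eq)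
    moreover have "\<dots> \<longleftrightarrow> (\<forall>f\<in>code. f \<noteq> p \<longrightarrow> \<delta> * (r / 4) < dist f p)"
      using near by (meson not_le)
    moreover have "D \<subseteq> code"
      by (auto simp: code_def)
    ultimately show ?thesis
      using mem_D_iff_isolated[of p] mem_D_iff_isolated[of q] pc by blast
  qed
  obtain y where y: "x = g y" "y \<in> D"
    using D_sub[of x] x l_pos by auto
  obtain W where W: "W \<in> words x"
    and det: "\<And>g h. g \<in> \<Gamma> \<Longrightarrow> h \<in> \<Gamma> \<Longrightarrow> g x = h x \<Longrightarrow> map g W = map h W \<Longrightarrow> g = h"
    using ex_spanning_word[OF x] by blast
  let ?e = "satellite x W"
  have e: "\<delta> * (r / 2) \<le> dist x ?e" "dist x ?e \<le> r / 8" "?e \<in> code"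
    using dist_satellite_bounds[OF x W] x W by (auto simp: code_def)
  have "dist x ?e \<le> 2 * l"
    using e r_le_l r_pos by linarith
  then have "?e \<in> g ` code"
    using code_iff e by blast
  then obtain f where f: "f \<in> code" "?e = g f"
    by blast
  have fe: "dist y f = dist x ?e"
    using f y g by simp
  have "dist y f \<le> r / 8" "f \<noteq> y"
    using e fe \<delta>r by auto
  then obtain V where V: "V \<in> words y" "f = satellite y V"
    using satellite_cases[OF f(1) y(2)] by blast
  have "\<sigma> (y, V) * norm (offset y V) = \<sigma> (x, W) * norm (offset x W)"
    using fe \<delta>_pos dist_satellite[OF x W] dist_satellite[OF y(2) V(1)] V(2) by simp
  then have st: "((y, V), (x, W)) \<in> same_type"
    using \<sigma>_separates[OF y(2) V(1) x W] by blast
  then obtain h where h: "h \<in> \<Gamma>" "A h x" "h y = x" "map h V = W"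
    by (auto simp: same_type_def)
  have "x + (\<delta> * \<sigma> (x, W)) *\<^sub>R offset x W = x + (\<delta> * \<sigma> (x, W)) *\<^sub>R offset x (map g V)"
    using f V \<sigma>_same_type[OF st] isometry_expansion[OF g, of y "\<delta> * \<sigma> (x, W)" \<mu> V] y(1)
    by (simp add: satellite_def)
  then have "offset x W = offset x (map g V)"
    using \<delta>_pos \<sigma>_bounds(1)[OF x W] by auto
  moreover have "map g V \<in> words x"
  proof -
    have "g ` set V \<subseteq> D \<inter> cball x l"
    proof
      fix p assume "p \<in> g ` set V"
      then obtain v where v: "p = g v" "v \<in> set V"
        by blast
      moreover have "set V \<subseteq> D \<inter> cball y l"
        using V by (simp add: words_def)
      ultimately have v: "p = g v" "v \<in> D" "dist y v \<le> l"
        by auto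
      then have "dist x p \<le> l"
        using y g by simp
      then show "p \<in> D \<inter> cball x l"
        using D_sub[of p] v by auto
    qed
    moreover have "hd (map g V) \<noteq> x"
      using V(1) inj_isometry[OF g] y(1) by (cases V) (auto simp: words_def inj_def)
    ultimately show ?thesis
      using V by (simp add: words_def)
  qed
  moreover have "0 < \<mu> ^ DIM('a) * (r / 2)"
    using \<mu>_pos r_pos by simp
  ultimately have gV: "map g V = W"
    using offset_separated[OF W, of "map g V"] by (cases "W = map g V") auto
  have "h \<circ> inv_into UNIV g = id"
  proof (rule det)
    have "map (h \<circ> inv_into UNIV g) W = map (h \<circ> inv_into UNIV g) (map g V)"
      by (simp only: gV)
    also have "\<dots> = map h V"
      using g by (simp add: comp_def)
    finally show "map (h \<circ> inv_into UNIV g) W = map id W"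
      using h(4) by simp
    show "(h \<circ> inv_into UNIV g) x = id x"
      using h(3) g y(1) by simp
  qed (use g h in auto)
  then have "h = g"
    using g by (metis comp_assoc comp_id id_comp inv_comp(1))
  then show ?thesis
    using h by simp
qed

end


section \<open>Local derivability\<close>

locale euclidean_pattern_space = isometric_pattern_space \<Gamma> X
  for \<Gamma> :: "('a::euclidean_space \<Rightarrow> 'a) set"
    and X :: "('p, 'a, 'a \<Rightarrow> 'a, 'm) pattern_space_scheme" (structure) +
  assumes translation_mem [simp]: "(\<lambda>x. a + x) \<in> \<Gamma>"

sublocale euclidean_pattern_space \<subseteq> euclidean_isometry_subgroup \<Gamma>
  by unfold_locales

text \<open>With all translations at hand the base points in the definition of local derivability can be
  moved to any common point \<open>z\<close>.\<close>

lemma locally_derivable_iff_agree: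
  assumes X: "euclidean_pattern_space \<Gamma> X" and Y: "euclidean_pattern_space \<Gamma> Y"
    and P: "P \<in> carrier X" and Q: "Q \<in> carrier Y"
  shows "locally_derivable (group_of_isometries \<Gamma>) X P Y Q \<longleftrightarrow>
    (\<exists>R\<^sub>1\<ge>0. \<forall>g\<in>\<Gamma>. \<forall>z. \<forall>R\<ge>0. isometric_pattern_space.agree X P g z (R + R\<^sub>1) \<longrightarrow>
       isometric_pattern_space.agree Y Q g z R)"
proof -
  interpret X: euclidean_pattern_space \<Gamma> X by (fact X)
  interpret Y: euclidean_pattern_space \<Gamma> Y by (fact Y)
  show ?thesis
  proof
    assume "locally_derivable (group_of_isometries \<Gamma>) X P Y Q"
    then have "\<exists>x0 y0 R0. R0 \<ge> 0 \<and> (\<forall>g\<in>\<Gamma>. \<forall>h\<in>\<Gamma>. \<forall>R\<ge>0.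
        act X g P \<curlywedge>\<^bsub>X\<^esub> cball x0 (R + R0) = act X h P \<curlywedge>\<^bsub>X\<^esub> cball x0 (R + R0) \<longrightarrow>
        act Y g Q \<curlywedge>\<^bsub>Y\<^esub> cball y0 R = act Y h Q \<curlywedge>\<^bsub>Y\<^esub> cball y0 R)"
      unfolding locally_derivable_def by simp
    then obtain x0 y0 R0 where R0: "R0 \<ge> 0" and ld': "\<forall>g\<in>\<Gamma>. \<forall>h\<in>\<Gamma>. \<forall>R\<ge>0.
        act X g P \<curlywedge>\<^bsub>X\<^esub> cball x0 (R + R0) = act X h P \<curlywedge>\<^bsub>X\<^esub> cball x0 (R + R0) \<longrightarrow>
        act Y g Q \<curlywedge>\<^bsub>Y\<^esub> cball y0 R = act Y h Q \<curlywedge>\<^bsub>Y\<^esub> cball y0 R"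
      by (elim exE conjE) (rule that)
    note ld = ld'[rule_format]
    let ?c = "dist x0 y0"
    have "Y.agree Q g z R" if g: "g \<in> \<Gamma>" and R: "R \<ge> 0" and ag: "X.agree P g z (R + (R0 + ?c))"
      for g z R
    proof -
      let ?t = "\<lambda>x. (x0 - z) + x"
      have t: "?t \<in> \<Gamma>"
        by simp
      have "act X ?t (act X g P \<curlywedge>\<^bsub>X\<^esub> cball z (R + (R0 + ?c))) =
          act X ?t (P \<curlywedge>\<^bsub>X\<^esub> cball z (R + (R0 + ?c)))"
        using ag by (simp add: X.agree_def)
      then have "act X (?t \<circ> g) P \<curlywedge>\<^bsub>X\<^esub> cball x0 ((R + ?c) + R0) =
          act X ?t P \<curlywedge>\<^bsub>X\<^esub> cball x0 ((R + ?c) + R0)"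
        using X.act_cut[OF t] X.act_comp[OF t g P] X.image_cball_isometry[OF t] g P
        by (simp add: add_ac)
      then have "act Y (?t \<circ> g) Q \<curlywedge>\<^bsub>Y\<^esub> cball y0 (R + ?c) = act Y ?t Q \<curlywedge>\<^bsub>Y\<^esub> cball y0 (R + ?c)"
        using ld[of "?t \<circ> g" ?t "R + ?c"] t g R by (simp del: X.translation_mem)
      moreover have "cball x0 R \<subseteq> cball y0 (R + ?c)"
        by (simp add: cball_subset_cball_iff dist_commute)
      ultimately have "act Y (?t \<circ> g) Q \<curlywedge>\<^bsub>Y\<^esub> cball x0 R = act Y ?t Q \<curlywedge>\<^bsub>Y\<^esub> cball x0 R"
        using Y.cut_cong_subset[of "act Y (?t \<circ> g) Q" "act Y ?t Q" "cball y0 (R + ?c)" "cball x0 R"]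
          t g Q by (simp del: X.translation_mem)
      then have "act Y ?t (act Y g Q \<curlywedge>\<^bsub>Y\<^esub> cball z R) = act Y ?t (Q \<curlywedge>\<^bsub>Y\<^esub> cball z R)"
        using Y.act_cut[OF t] Y.act_comp[OF t g Q] X.image_cball_isometry[OF t] g Q by simp
      then have "act Y (inv_into UNIV ?t) (act Y ?t (act Y g Q \<curlywedge>\<^bsub>Y\<^esub> cball z R)) =
          act Y (inv_into UNIV ?t) (act Y ?t (Q \<curlywedge>\<^bsub>Y\<^esub> cball z R))"
        by simp
      then show ?thesis
        using Y.act_inv(2)[OF t] Y.cut_closed g Q by (simp add: Y.agree_def)
    qed
    then show "\<exists>R\<^sub>1\<ge>0. \<forall>g\<in>\<Gamma>. \<forall>z. \<forall>R\<ge>0. X.agree P g z (R + R\<^sub>1) \<longrightarrow> Y.agree Q g z R"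
      using R0 by (intro exI[of _ "R0 + ?c"]) auto
  next
    assume "\<exists>R\<^sub>1\<ge>0. \<forall>g\<in>\<Gamma>. \<forall>z. \<forall>R\<ge>0. X.agree P g z (R + R\<^sub>1) \<longrightarrow> Y.agree Q g z R"
    then obtain R1 where R1: "R1 \<ge> 0" and ld: "\<And>g z R. g \<in> \<Gamma> \<Longrightarrow> R \<ge> 0 \<Longrightarrow>
        X.agree P g z (R + R1) \<Longrightarrow> Y.agree Q g z R"
      by blast
    have "act Y g Q \<curlywedge>\<^bsub>Y\<^esub> cball 0 R = act Y h Q \<curlywedge>\<^bsub>Y\<^esub> cball 0 R"
      if g: "g \<in> \<Gamma>" and h: "h \<in> \<Gamma>" and R: "R \<ge> 0"
        and eq: "act X g P \<curlywedge>\<^bsub>X\<^esub> cball 0 (R + R1) = act X h P \<curlywedge>\<^bsub>X\<^esub> cball 0 (R + R1)" for g h R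
    proof -
      let ?i = "inv_into UNIV h"
      have i: "?i \<in> \<Gamma>" "?i \<circ> g \<in> \<Gamma>"
        using g h by simp_all
      have "act X ?i (act X g P \<curlywedge>\<^bsub>X\<^esub> cball 0 (R + R1)) = act X ?i (act X h P \<curlywedge>\<^bsub>X\<^esub> cball 0 (R + R1))"
        using eq by simp
      then have "X.agree P (?i \<circ> g) (?i 0) (R + R1)"
        using g h i P by (simp add: X.agree_def X.act_cut X.act_comp)
      then have "Y.agree Q (?i \<circ> g) (?i 0) R"
        using ld[OF i(2) R] by blast
      then have "act Y h (act Y (?i \<circ> g) Q \<curlywedge>\<^bsub>Y\<^esub> cball (?i 0) R) = act Y h (Q \<curlywedge>\<^bsub>Y\<^esub> cball (?i 0) R)"
        by (simp add: Y.agree_def)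
      then show ?thesis
        using g h i Q by (simp add: Y.act_cut Y.act_comp)
    qed
    then have "R1 \<ge> 0 \<and> (\<forall>g\<in>\<Gamma>. \<forall>h\<in>\<Gamma>. \<forall>R\<ge>0.
        act X g P \<curlywedge>\<^bsub>X\<^esub> cball 0 (R + R1) = act X h P \<curlywedge>\<^bsub>X\<^esub> cball 0 (R + R1) \<longrightarrow>
        act Y g Q \<curlywedge>\<^bsub>Y\<^esub> cball 0 R = act Y h Q \<curlywedge>\<^bsub>Y\<^esub> cball 0 R)"
      using R1 by blast
    moreover have "carrier (group_of_isometries \<Gamma>) = \<Gamma>"
      by simp
    ultimately show "locally_derivable (group_of_isometries \<Gamma>) X P Y Q"
      unfolding locally_derivable_def by metis
  qed
qed


section \<open>Patterns with bounded components are determined by local parts\<close>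

context isometric_pattern_space
begin

text \<open>A finite family of parts of \<open>P\<close> has a supremum below \<open>P\<close>. If the supports of the parts cover that
  of \<open>P\<close>, the supremum has the same support as \<open>P\<close>, hence is \<open>P\<close>.\<close>

lemma eq_if_locally_eq:
  assumes glue: "glueable X" and P: "P \<in> carrier X" and Q: "Q \<in> carrier X" and F: "finite F"
    and eq: "\<And>x. x \<in> F \<Longrightarrow> P \<curlywedge> cball x L = Q \<curlywedge> cball x L"
    and covP: "\<And>w. w \<in> supp X P \<Longrightarrow> \<exists>x\<in>F. w \<in> supp X (P \<curlywedge> cball x L)"
    and covQ: "\<And>w. w \<in> supp X Q \<Longrightarrow> \<exists>x\<in>F. w \<in> supp X (Q \<curlywedge> cball x L)"
    and ne: "F \<noteq> {}"
  shows "P = Q"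
proof -
  have sup: "is_supremum X ((\<lambda>x. P \<curlywedge> cball x L) ` F) P" if P: "P \<in> carrier X"
    and cov: "\<And>w. w \<in> supp X P \<Longrightarrow> \<exists>x\<in>F. w \<in> supp X (P \<curlywedge> cball x L)" for P
  proof -
    let ?\<Xi> = "(\<lambda>x. P \<curlywedge> cball x L) ` F"
    have sub: "?\<Xi> \<subseteq> carrier X"
      using P cut_closed by auto
    have le: "T \<preceq> P" if "T \<in> ?\<Xi>" for T
      using belowI[OF P closed_cball] that by blast
    have lf: "locally_finite_patterns X ?\<Xi>"
      using F by (simp add: locally_finite_patterns_def cut_set_def)
    have pc: "pairwise_compatible X ?\<Xi>"
      unfolding pairwise_compatible_def compatible_iff using le P by blast
    obtain T where T: "is_supremum X ?\<Xi> T"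
      using glue[unfolded glueable_def, rule_format, OF sub lf pc] by blast
    note T' = T[unfolded is_supremum_iff]
    have TP: "T \<preceq> P"
      using T' le P by blast
    have "supp X P \<subseteq> supp X T"
    proof
      fix w assume "w \<in> supp X P"
      then obtain x where "x \<in> F" "w \<in> supp X (P \<curlywedge> cball x L)"
        using cov by blast
      moreover have "P \<curlywedge> cball x L \<preceq> T"
        using T' sub \<open>x \<in> F\<close> by blast
      ultimately show "w \<in> supp X T"
        using supp_mono[of "P \<curlywedge> cball x L" T] T' P cut_closed by auto
    qed
    then have "P \<curlywedge> supp X T = P"
      using cut_eq_iff[OF P closed_supp] T' by simp
    then show ?thesis
      using TP T by simp
  qed
  have "(\<lambda>x. P \<curlywedge> cball x L) ` F = (\<lambda>x. Q \<curlywedge> cball x L) ` F"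
    using eq by (intro image_cong) auto
  then show ?thesis
    using sup[OF P covP] sup[OF Q covQ] is_supremum_unique by metis
qed

lemma bounded_components_act:
  assumes g: "g \<in> \<Gamma>" and P: "P \<in> carrier X" and C: "closed C"
    and bc: "\<And>C x. closed C \<Longrightarrow> x \<in> supp X (P \<curlywedge> C) \<Longrightarrow> x \<in> supp X (P \<curlywedge> C \<curlywedge> cball x R)"
    and w: "w \<in> supp X (act X g P \<curlywedge> C)"
  shows "w \<in> supp X (act X g P \<curlywedge> C \<curlywedge> cball w R)"
proof -
  let ?C = "inv_into UNIV g ` C" and ?w = "inv_into UNIV g w"
  have C': "closed ?C"
    using closed_image_isometry[OF inv_mem[OF g] C] .
  have eq: "act X g P \<curlywedge> C = act X g (P \<curlywedge> ?C)"
    using act_cut[OF g P C'] g by simp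
  have PC: "P \<curlywedge> ?C \<in> carrier X"
    using cut_closed[OF P C'] .
  have eq': "act X g P \<curlywedge> C \<curlywedge> cball w R = act X g (P \<curlywedge> ?C \<curlywedge> cball ?w R)"
    using act_cut[OF g PC closed_cball] g by (simp add: eq)
  have "?w \<in> supp X (P \<curlywedge> ?C)"
    using w supp_act[OF g PC] g by (auto simp: eq)
  then have "?w \<in> supp X (P \<curlywedge> ?C \<curlywedge> cball ?w R)"
    using bc[OF C'] by blast
  then have "g ?w \<in> supp X (act X g (P \<curlywedge> ?C \<curlywedge> cball ?w R))"
    using supp_act[OF g cut_closed[OF PC closed_cball]] by blast
  then show ?thesis
    using g by (simp add: eq')
qed

lemma agree_if_locally_agree:
  assumes glue: "glueable X" and P: "P \<in> carrier X" and g: "g \<in> \<Gamma>"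
    and bc: "\<And>C x. closed C \<Longrightarrow> x \<in> supp X (P \<curlywedge> C) \<Longrightarrow> x \<in> supp X (P \<curlywedge> C \<curlywedge> cball x R\<^sub>P)"
    and F: "finite F" "F \<noteq> {}" and ag: "\<And>x. x \<in> F \<Longrightarrow> agree P g x L"
    and cov: "\<And>w. w \<in> cball z R \<Longrightarrow> \<exists>x\<in>F. cball w R\<^sub>P \<subseteq> cball x L"
  shows "agree P g z R"
proof -
  let ?C = "cball z R"
  have gP: "act X g P \<in> carrier X"
    using g P by simp
  have covQ: "\<exists>x\<in>F. w \<in> supp X (Q \<curlywedge> ?C \<curlywedge> cball x L)"
    if Q: "Q \<in> carrier X" and w: "w \<in> supp X (Q \<curlywedge> ?C)"
      and bcQ: "w \<in> supp X (Q \<curlywedge> ?C) \<Longrightarrow> w \<in> supp X (Q \<curlywedge> ?C \<curlywedge> cball w R\<^sub>P)" for Q w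
  proof -
    have QC: "Q \<curlywedge> ?C \<in> carrier X"
      using cut_closed[OF Q closed_cball] .
    have "w \<in> ?C"
      using w supp_cut_subset[OF Q closed_cball] by blast
    then obtain x where x: "x \<in> F" "cball w R\<^sub>P \<subseteq> cball x L"
      using cov by blast
    have "Q \<curlywedge> ?C \<curlywedge> cball w R\<^sub>P \<preceq> Q \<curlywedge> ?C \<curlywedge> cball x L"
      using belowI[OF cut_closed[OF QC closed_cball[of x L]] closed_cball[of w "R\<^sub>P"]]
        cut_cut[OF QC closed_cball[of x L] closed_cball[of w "R\<^sub>P"]] x by (simp add: Int_absorb1)
    then show ?thesis
      using supp_mono[OF cut_closed[OF QC closed_cball] cut_closed[OF QC closed_cball]]
        bcQ[OF w] x by blast
  qed
  have "act X g P \<curlywedge> ?C = P \<curlywedge> ?C"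
  proof (rule eq_if_locally_eq[OF glue cut_closed[OF gP closed_cball] cut_closed[OF P closed_cball] F(1)])
    fix x assume "x \<in> F"
    then have "act X g P \<curlywedge> cball x L = P \<curlywedge> cball x L"
      using ag by (simp add: agree_def)
    then have "act X g P \<curlywedge> cball x L \<curlywedge> ?C = P \<curlywedge> cball x L \<curlywedge> ?C"
      by simp
    then show "act X g P \<curlywedge> ?C \<curlywedge> cball x L = P \<curlywedge> ?C \<curlywedge> cball x L"
      using cut_cut[OF gP] cut_cut[OF P] by (simp add: Int_commute)
  next
    fix w assume w: "w \<in> supp X (act X g P \<curlywedge> ?C)"
    show "\<exists>x\<in>F. w \<in> supp X (act X g P \<curlywedge> ?C \<curlywedge> cball x L)"
      by (rule covQ[OF gP w bounded_components_act[OF g P closed_cball bc]])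
  next
    fix w assume w: "w \<in> supp X (P \<curlywedge> ?C)"
    show "\<exists>x\<in>F. w \<in> supp X (P \<curlywedge> ?C \<curlywedge> cball x L)"
      by (rule covQ[OF P w bc[OF closed_cball]])
  qed (rule F(2))
  then show ?thesis
    by (simp add: agree_def)
qed

end


section \<open>Gluing copies of a symmetric building block\<close>

text \<open>A point of \<open>K\<close> that is extremal in the direction \<open>v\<close> cannot be moved further in this direction.\<close>

lemma compact_translate_subset_imp_0:
  fixes K :: "'a::euclidean_space set"
  assumes "compact K" "K \<noteq> {}" "(\<lambda>y. v + y) ` K \<subseteq> K"
  shows "v = 0"
proof -
  have "continuous_on K (\<lambda>y. v \<bullet> y)"
    by (intro continuous_intros)
  then obtain p where p: "p \<in> K" "\<forall>y\<in>K. v \<bullet> y \<le> v \<bullet> p"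
    using continuous_attains_sup[OF assms(1,2)] by blast
  then have "v \<bullet> (v + p) \<le> v \<bullet> p"
    using assms(3) by blast
  then have "v \<bullet> v \<le> 0"
    by (simp add: inner_add_right)
  then show ?thesis
    using inner_gt_zero_iff[of v] by fastforce
qed

locale symmetric_block = euclidean_pattern_space \<Gamma> X
  for \<Gamma> :: "('a::euclidean_space \<Rightarrow> 'a) set"
    and X :: "('p, 'a, 'a \<Rightarrow> 'a, 'm) pattern_space_scheme" (structure) +
  fixes \<Sigma>' :: "'p set" and \<rho> :: real and B :: 'p
  assumes glueable: "glueable X"
    and subshift: "subshift (group_of_isometries \<Gamma>) X \<Sigma>'"
    and supremum_closed: "supremum_closed X \<Sigma>'"
    and \<rho>_pos: "\<rho> > 0"
    and block: "symmetric_building_block (group_of_isometries \<Gamma>) (\<lambda>\<gamma>. \<gamma>) X \<Sigma>' \<rho> B"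
begin

definition copy :: "'a \<Rightarrow> 'p" where
  "copy x = act X (\<lambda>y. x + y) B"

text \<open>The part with empty support that all copies have in common; the copy at 0 is an arbitrary choice.\<close>

abbreviation vacuous :: 'p where "vacuous \<equiv> copy 0 \<curlywedge> {}"

text \<open>The case \<open>C = UNIV\<close> says that \<open>S\<close> itself is the supremum of the copies.\<close>

definition glues :: "'a set \<Rightarrow> 'p \<Rightarrow> bool" where
  "glues E S \<longleftrightarrow> S \<in> carrier X \<and> (\<forall>C. closed C \<longrightarrow> is_supremum X (cut_set X (copy ` E) C) (S \<curlywedge> C))"

lemma block_family:
  obtains F where "building_block_family (group_of_isometries \<Gamma>) (\<lambda>\<gamma>. \<gamma>) X \<Sigma>' \<rho> F" "B \<in> F"
  using block unfolding symmetric_building_block_def building_block_def by blast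

lemma B_\<Sigma>: "B \<in> \<Sigma>'" and B_supp: "supp X B \<noteq> {}" "supp X B \<subseteq> cball 0 \<rho>"
proof -
  obtain F where F: "building_block_family (group_of_isometries \<Gamma>) (\<lambda>\<gamma>. \<gamma>) X \<Sigma>' \<rho> F" "B \<in> F"
    by (rule block_family)
  note f = F(1)[unfolded building_block_family_def]
  have "F \<subseteq> \<Sigma>'" "\<forall>P\<in>F. supp X P \<noteq> {} \<and> supp X P \<subseteq> cball 0 \<rho>"
    using conjunct1[OF f] conjunct1[OF conjunct2[OF conjunct2[OF f]]] by blast+
  then show "B \<in> \<Sigma>'" "supp X B \<noteq> {}" "supp X B \<subseteq> cball 0 \<rho>"
    using F(2) by blast+
qed

lemma B_compatible:
  assumes "g \<in> \<Gamma>" "h \<in> \<Gamma>" "dist (g 0) (h 0) > 4 * \<rho>"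
  shows "compatible X (act X g B) (act X h B)"
proof -
  obtain F where F: "building_block_family (group_of_isometries \<Gamma>) (\<lambda>\<gamma>. \<gamma>) X \<Sigma>' \<rho> F" "B \<in> F"
    by (rule block_family)
  note f = F(1)[unfolded building_block_family_def]
  have "\<forall>g\<in>carrier (group_of_isometries \<Gamma>). \<forall>h\<in>carrier (group_of_isometries \<Gamma>). \<forall>P\<in>F. \<forall>Q\<in>F.
      4 * \<rho> < dist (g 0) (h 0) \<longrightarrow> compatible X (act X g P) (act X h Q)"
    using conjunct1[OF conjunct2[OF conjunct2[OF conjunct2[OF f]]]] .
  then show ?thesis
    using assms F(2) by simp
qed

lemma B_fixed: "act X g B = B" if "g \<in> \<Gamma>" "g 0 = 0"
proof -
  have "g \<in> stabilizer (group_of_isometries \<Gamma>) (\<lambda>\<gamma>. \<gamma>) 0"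
    using that by (simp add: stabilizer_def)
  then show ?thesis
    using block unfolding symmetric_building_block_def stabilizer_def by blast
qed

lemma B_carrier [simp]: "B \<in> carrier X"
  using B_\<Sigma> subshift unfolding subshift_def by blast

lemma copy_carrier [simp]: "copy x \<in> carrier X"
  by (simp add: copy_def)

lemma copy_\<Sigma>: "copy x \<in> \<Sigma>'"
  using B_\<Sigma> subshift translation_mem[of x] unfolding subshift_def copy_def by simp

text \<open>Only the position of a copy of the symmetric block matters, not the isometry that moved it there.\<close>

lemma act_copy: "act X g (copy x) = copy (g x)" if g: "g \<in> \<Gamma>"
proof -
  let ?s = "\<lambda>y. x + y" and ?t = "\<lambda>y. g x + y" and ?u = "\<lambda>y. - g x + y"
  let ?h = "?u \<circ> (g \<circ> ?s)"
  have mem: "?s \<in> \<Gamma>" "?t \<in> \<Gamma>" "?u \<in> \<Gamma>"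
    by (rule translation_mem)+
  then have h: "?h \<in> \<Gamma>" "?h 0 = 0"
    using g comp_mem[OF mem(3) comp_mem[OF g mem(1)]] by auto
  have "?t \<circ> ?h = g \<circ> ?s"
    by (auto simp: fun_eq_iff)
  then have "act X g (copy x) = act X (?t \<circ> ?h) B"
    using act_comp[OF g mem(1) B_carrier] by (simp add: copy_def)
  also have "\<dots> = copy (g x)"
    unfolding copy_def act_comp[OF mem(2) h(1) B_carrier] B_fixed[OF h] ..
  finally show ?thesis .
qed

lemma supp_copy: "supp X (copy x) = (\<lambda>y. x + y) ` supp X B"
  unfolding copy_def by (rule supp_act[OF translation_mem B_carrier])

lemma supp_copy_nonempty: "supp X (copy x) \<noteq> {}"
  using B_supp by (simp add: supp_copy)

lemma supp_copy_subset: "supp X (copy x) \<subseteq> cball x \<rho>"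
  using image_mono[OF B_supp(2), of "\<lambda>y. x + y"]
  unfolding supp_copy image_cball_isometry[OF translation_mem] by simp

lemma supp_copy_subset_imp_eq: "x = y" if "supp X (copy x) \<subseteq> supp X (copy y)"
proof -
  have "supp X B = supp X B \<inter> cball 0 \<rho>"
    using B_supp(2) by blast
  then have "compact (supp X B)"
    using compact_cball closed_supp[OF B_carrier] closed_Int_compact by metis
  moreover have "(\<lambda>z. (x - y) + z) ` supp X B \<subseteq> supp X B"
  proof
    fix p assume "p \<in> (\<lambda>z. (x - y) + z) ` supp X B"
    then obtain z where "z \<in> supp X B" "p = (x - y) + z"
      by blast
    moreover from this have "x + z \<in> supp X (copy y)"
      using \<open>supp X (copy x) \<subseteq> supp X (copy y)\<close> by (auto simp: supp_copy)
    then obtain q where "x + z = y + q" "q \<in> supp X B"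
      by (auto simp: supp_copy)
    ultimately show "p \<in> supp X B"
      by (metis add_diff_cancel_left' diff_add_eq)
  qed
  ultimately have "x - y = 0"
    using compact_translate_subset_imp_0[of "supp X B" "x - y"] B_supp(1) by blast
  then show ?thesis
    by simp
qed

lemma copy_compatible: "compatible X (copy x) (copy y)" if "dist x y > 4 * \<rho>"
  unfolding copy_def using B_compatible[OF translation_mem translation_mem, of x y] that by simp

text \<open>Copies close to each other need not be compatible, but both are compatible with one far away.\<close>

lemma copy_cut_empty: "copy x \<curlywedge> {} = vacuous"
proof -
  obtain b :: 'a where "b \<in> Basis"
    using nonempty_Basis by blast
  define z where "z = (4 * \<rho> + norm x + 1) *\<^sub>R b"
  have z: "norm z = 4 * \<rho> + norm x + 1"
    using \<open>b \<in> Basis\<close> \<rho>_pos by (simp add: z_def)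
  then have "dist x z > 4 * \<rho>"
    using norm_triangle_sub[of z x] by (simp add: dist_norm norm_minus_commute)
  moreover have "dist 0 z = norm z"
    by simp
  then have "dist 0 z > 4 * \<rho>"
    using z norm_ge_zero[of x] by linarith
  ultimately have "copy x \<curlywedge> {} = copy z \<curlywedge> {}" "vacuous = copy z \<curlywedge> {}"
    using compatible_cut_empty copy_compatible by simp_all
  then show ?thesis
    by simp
qed

lemma copy_cut_far: "copy x \<curlywedge> cball z R = vacuous" if "dist z x > R + \<rho>"
proof -
  have "cball x \<rho> \<inter> cball z R = {}"
  proof (intro equals0I)
    fix p assume "p \<in> cball x \<rho> \<inter> cball z R"
    then show False
      using that dist_triangle[of z x p] by (simp add: dist_commute)
  qed
  then have "supp X (copy x) \<inter> cball z R = {}"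
    using Int_mono[OF supp_copy_subset[of x] subset_refl[of "cball z R"]]
    by (simp only: subset_empty)
  then show ?thesis
    by (rule trans[OF cut_disjoint[OF copy_carrier closed_cball] copy_cut_empty])
qed

text \<open>All copies beyond the reach of the ball contribute the same part, and a copy of this kind
  always exists when \<open>E\<close> is unbounded. So the cut set depends only on the points of \<open>E\<close> near the ball.\<close>

lemma cut_set_copies:
  assumes "\<exists>x\<in>E. dist z x > R + \<rho>"
  shows "cut_set X (copy ` E) (cball z R) =
           insert vacuous ((\<lambda>x. copy x \<curlywedge> cball z R) ` (E \<inter> cball z (R + \<rho>)))" (is "?L = ?R")
proof
  show "?L \<subseteq> ?R"
  proof
    fix Q assume "Q \<in> ?L"
    then obtain x where x: "x \<in> E" "Q = copy x \<curlywedge> cball z R"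
      by (auto simp: cut_set_def)
    show "Q \<in> ?R"
    proof (cases "x \<in> cball z (R + \<rho>)")
      case False
      then have "Q = vacuous"
        using x(2) copy_cut_far[of R z x] by simp
      then show ?thesis
        by blast
    qed (use x in blast)
  qed
  obtain x where "x \<in> E" "dist z x > R + \<rho>"
    using assms by blast
  then have "vacuous \<in> ?L"
    using copy_cut_far[of R z x] unfolding cut_set_def by (metis image_eqI)
  then show "?R \<subseteq> ?L"
    unfolding cut_set_def by blast
qed

lemma ex_glues:
  assumes sep: "\<And>x y. x \<in> E \<Longrightarrow> y \<in> E \<Longrightarrow> x \<noteq> y \<Longrightarrow> 4 * \<rho> < dist x y"
    and far: "\<And>z R. \<exists>x\<in>E. R < dist z x"
  shows "\<exists>S\<in>\<Sigma>'. glues E S"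
proof -
  let ?\<Xi> = "copy ` E"
  have sub: "?\<Xi> \<subseteq> carrier X" "?\<Xi> \<subseteq> \<Sigma>'"
    using copy_\<Sigma> by auto
  have "uniform_discrete E"
    unfolding uniform_discrete_def using sep \<rho>_pos
    by (intro exI[of _ "4 * \<rho>"]) (auto dest: less_asym)
  then have "finite (E \<inter> cball z R)" for z R
    using uniform_discrete_finite_iff[of "E \<inter> cball z R"] uniform_discrete_subset
    by (meson Int_lower1 bounded_Int bounded_cball)
  then have lf: "locally_finite_patterns X ?\<Xi>"
    unfolding locally_finite_patterns_def using cut_set_copies far by simp
  have pc: "pairwise_compatible X ?\<Xi>"
    unfolding pairwise_compatible_def
  proof (intro ballI)
    fix P Q assume "P \<in> ?\<Xi>" "Q \<in> ?\<Xi>"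
    then obtain x y where xy: "P = copy x" "Q = copy y" "x \<in> E" "y \<in> E"
      by blast
    show "compatible X P Q"
    proof (cases "x = y")
      case True
      then show ?thesis
        using xy below_refl[OF copy_carrier, of y] unfolding compatible_iff by auto
    next
      case False
      then show ?thesis
        using copy_compatible sep xy by blast
    qed
  qed
  obtain S where S: "S \<in> \<Sigma>'" "is_supremum X ?\<Xi> S"
    using supremum_closed[unfolded supremum_closed_def, rule_format, OF sub(2) lf pc] by blast
  obtain T where T: "is_supremum X ?\<Xi> T"
    "\<forall>C. closed C \<longrightarrow> is_supremum X (cut_set X ?\<Xi> C) (T \<curlywedge> C)"
    using glueable[unfolded glueable_def, rule_format, OF sub(1) lf pc] by blast
  have "T = S"
    using is_supremum_unique[OF T(1) S(2)] .
  moreover have "S \<in> carrier X"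
    using S(1) subshift by (auto simp: subshift_def)
  ultimately show ?thesis
    using S(1) T(2) unfolding glues_def by blast
qed

lemma glues_carrier: "glues E S \<Longrightarrow> S \<in> carrier X"
  unfolding glues_def by (rule conjunct1)

lemma glues_cut: "is_supremum X (cut_set X (copy ` E) C) (S \<curlywedge> C)" if "glues E S" "closed C"
  using conjunct2[OF that(1)[unfolded glues_def], rule_format, OF that(2)] .

lemma act_copy_cut:
  assumes g: "g \<in> \<Gamma>" and C: "closed C"
  shows "act X g (copy x \<curlywedge> C) = copy (g x) \<curlywedge> (g ` C)"
  using act_cut[OF g copy_carrier C] unfolding act_copy[OF g] .

lemma act_cut_set_copies:
  assumes g: "g \<in> \<Gamma>" and C: "closed C"
  shows "act X g ` cut_set X (copy ` E) C = cut_set X (copy ` g ` E) (g ` C)"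
  unfolding cut_set_def image_image act_copy_cut[OF g C] ..

lemma glues_act:
  assumes g: "g \<in> \<Gamma>" and S: "glues E S"
  shows "glues (g ` E) (act X g S)"
proof -
  have Sc: "S \<in> carrier X"
    using S by (rule glues_carrier)
  have sup: "is_supremum X (cut_set X (copy ` g ` E) (g ` C)) (act X g S \<curlywedge> (g ` C))"
    if C: "closed C" for C
  proof -
    have sub: "cut_set X (copy ` E) C \<subseteq> carrier X"
      unfolding cut_set_def using cut_closed[OF copy_carrier C] by blast
    show ?thesis
      using is_supremum_act[OF g sub glues_cut[OF S C]]
      unfolding act_cut_set_copies[OF g C] act_cut[OF g Sc C] .
  qed
  have "is_supremum X (cut_set X (copy ` g ` E) C) (act X g S \<curlywedge> C)" if C: "closed C" for C
    using sup[OF closed_image_isometry[OF inv_mem[OF g] C]] unfolding image_inv_image(1)[OF g] .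
  then show ?thesis
    unfolding glues_def using act_closed[OF g Sc] by blast
qed

lemma glues_cut_cong:
  assumes S: "glues E S" and T: "glues E' T"
    and far: "\<And>z R. \<exists>x\<in>E. R < dist z x" "\<And>z R. \<exists>x\<in>E'. R < dist z x"
    and eq: "E \<inter> cball z (R + \<rho>) = E' \<inter> cball z (R + \<rho>)"
  shows "S \<curlywedge> cball z R = T \<curlywedge> cball z R"
proof (rule is_supremum_unique)
  show "is_supremum X (cut_set X (copy ` E) (cball z R)) (S \<curlywedge> cball z R)"
    using S closed_cball by (rule glues_cut)
  have "cut_set X (copy ` E) (cball z R) = cut_set X (copy ` E') (cball z R)"
    using cut_set_copies[OF far(1)] cut_set_copies[OF far(2)] eq by simp
  then show "is_supremum X (cut_set X (copy ` E) (cball z R)) (T \<curlywedge> cball z R)"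
    using glues_cut[OF T closed_cball, of z R] by simp
qed

text \<open>The ball around \<open>x\<close> meets at most one of the copies, because these have centres more than \<open>4\<rho>\<close> apart.
  If the part of \<open>S\<close> in the ball is a copy centred at \<open>x\<close>, then its support is contained in that of a
  copy centred at some \<open>y \<in> E\<close>, and a compact set does not contain a proper translate of itself.\<close>

lemma glues_mem_iff:
  assumes S: "glues E S"
    and sep: "\<And>x y. x \<in> E \<Longrightarrow> y \<in> E \<Longrightarrow> x \<noteq> y \<Longrightarrow> 4 * \<rho> < dist x y"
    and far: "\<And>z R. \<exists>x\<in>E. R < dist z x"
  shows "x \<in> E \<longleftrightarrow> S \<curlywedge> cball x \<rho> = copy x"
proof -
  let ?C = "cball x \<rho>"
  have sup: "is_supremum X (insert vacuous ((\<lambda>y. copy y \<curlywedge> ?C) ` (E \<inter> cball x (\<rho> + \<rho>)))) (S \<curlywedge> ?C)"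
    using glues_cut[OF S closed_cball] unfolding cut_set_copies[OF far, symmetric] .
  have one: "y = y'" if y: "y \<in> E \<inter> cball x (\<rho> + \<rho>)" and y': "y' \<in> E \<inter> cball x (\<rho> + \<rho>)" for y y'
  proof (rule ccontr)
    assume "y \<noteq> y'"
    then have "4 * \<rho> < dist y y'"
      using sep y y' by blast
    moreover have "dist y y' \<le> dist x y + dist x y'"
      by (rule dist_triangle3)
    ultimately show False
      using y y' by simp
  qed
  have Oc: "vacuous \<in> carrier X"
    using cut_closed[OF copy_carrier closed_empty] .
  have single: "is_supremum X {vacuous, copy y \<curlywedge> ?C} (copy y \<curlywedge> ?C)" for y
  proof -
    have yc: "copy y \<curlywedge> ?C \<in> carrier X"
      using cut_closed[OF copy_carrier closed_cball] .
    have "copy y \<curlywedge> ?C \<curlywedge> {} = vacuous"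
      using cut_cut[OF copy_carrier closed_cball closed_empty] copy_cut_empty by simp
    then have "vacuous \<preceq> copy y \<curlywedge> ?C"
      using belowI[OF yc closed_empty] by blast
    then show ?thesis
      using below_refl[OF yc] yc by (auto simp: is_supremum_iff)
  qed
  have eq: "S \<curlywedge> ?C = copy y \<curlywedge> ?C" if "y \<in> E \<inter> cball x (\<rho> + \<rho>)" for y
  proof -
    have "E \<inter> cball x (\<rho> + \<rho>) = {y}"
      using one[OF _ that] that by blast
    then show ?thesis
      using is_supremum_unique[OF sup] single[of y] by simp
  qed
  show ?thesis
  proof
    assume "x \<in> E"
    then show "S \<curlywedge> ?C = copy x"
      using eq[of x] \<rho>_pos cut_eq_iff[OF copy_carrier closed_cball] supp_copy_subset[of x] by simp
  next
    assume Sx: "S \<curlywedge> ?C = copy x"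
    show "x \<in> E"
    proof (cases "E \<inter> cball x (\<rho> + \<rho>) = {}")
      case True
      have "is_supremum X {vacuous} vacuous"
        using Oc below_refl[OF Oc] by (auto simp: is_supremum_iff)
      then have "copy x = vacuous"
        using is_supremum_unique[OF sup] True Sx by simp
      then have "supp X (copy x) = {}"
        using supp_cut_subset[OF copy_carrier closed_empty] by (metis Int_empty_right subset_empty)
      then show ?thesis
        using supp_copy_nonempty by blast
    next
      case False
      then obtain y where y: "y \<in> E \<inter> cball x (\<rho> + \<rho>)"
        by blast
      then have "supp X (copy x) \<subseteq> supp X (copy y)"
        using eq[OF y] Sx supp_cut_subset[OF copy_carrier closed_cball, of y x \<rho>] by auto
      then show ?thesis
        using supp_copy_subset_imp_eq y by blast
    qed
  qed
qed

end


section \<open>The derivable pattern\<close>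

lemma euclidean_pattern_spaceI:
  fixes \<Gamma> :: "('a::euclidean_space \<Rightarrow> 'a) set"
  assumes "subgroup \<Gamma> isometry_group"
    and "equivariant_pattern_space (group_of_isometries \<Gamma>) (\<lambda>\<gamma>. \<gamma>) X"
    and "\<forall>a. (\<lambda>x. a + x) \<in> \<Gamma>"
  shows "euclidean_pattern_space \<Gamma> X"
  using assms
  by (intro euclidean_pattern_space.intro isometric_pattern_space.intro isometry_subgroup.intro
      euclidean_pattern_space_axioms.intro) simp_all

theorem theorem4p25:
  fixes \<Gamma> :: "(real^'n \<Rightarrow> real^'n) set"
    and \<Pi>\<^sub>1 :: "('p, real^'n, real^'n \<Rightarrow> real^'n) pattern_space"
    and \<Pi>\<^sub>2 :: "('q, real^'n, real^'n \<Rightarrow> real^'n) pattern_space"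
    and \<Sigma>' :: "'q set"
    and P :: 'p
  assumes "subgroup \<Gamma> isometry_group"
    and "closed_in_isometry_group \<Gamma>"
    and "\<forall>a. (\<lambda>x. a + x) \<in> \<Gamma>"
    and "equivariant_pattern_space (group_of_isometries \<Gamma>) (\<lambda>\<gamma>. \<gamma>) \<Pi>\<^sub>1"
    and "glueable \<Pi>\<^sub>1"
    and "equivariant_pattern_space (group_of_isometries \<Gamma>) (\<lambda>\<gamma>. \<gamma>) \<Pi>\<^sub>2"
    and "glueable \<Pi>\<^sub>2"
    and "subshift (group_of_isometries \<Gamma>) \<Pi>\<^sub>2 \<Sigma>'"
    and "supremum_closed \<Pi>\<^sub>2 \<Sigma>'"
    and "\<forall>r>0. \<exists>B. symmetric_building_block (group_of_isometries \<Gamma>) (\<lambda>\<gamma>. \<gamma>) \<Pi>\<^sub>2 \<Sigma>' r B"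
    and "P \<in> carrier \<Pi>\<^sub>1"
    and "consists_of_bounded_components \<Pi>\<^sub>1 P"
    and "Delone_deriving (group_of_isometries \<Gamma>) (\<lambda>\<gamma>. \<gamma>) \<Pi>\<^sub>1 P"
  shows "\<exists>S\<in>\<Sigma>'. mutually_locally_derivable (group_of_isometries \<Gamma>) \<Pi>\<^sub>1 P \<Pi>\<^sub>2 S \<and>
                relatively_dense (supp \<Pi>\<^sub>2 S)"
proof -
  let ?G = "group_of_isometries \<Gamma>" and ?A = "\<lambda>\<gamma>::real^'n \<Rightarrow> real^'n. \<gamma>"
  interpret X: euclidean_pattern_space \<Gamma> \<Pi>\<^sub>1
    by (rule euclidean_pattern_spaceI[OF assms(1,4,3)])
  have Y: "euclidean_pattern_space \<Gamma> \<Pi>\<^sub>2"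
    by (rule euclidean_pattern_spaceI[OF assms(1,6,3)])
  have U: "euclidean_pattern_space \<Gamma> (UD ?A)"
  proof -
    have "equivariant_pattern_space ?G ?A (UD ?A)"
      by (rule equivariant_pattern_space_UD[OF X.group_G X.action_space]) simp
    then show ?thesis
      by (rule euclidean_pattern_spaceI[OF assms(1) _ assms(3)])
  qed
  interpret U: euclidean_pattern_space \<Gamma> "UD ?A"
    by (rule U)
  obtain R\<^sub>P where bc: "\<And>C x. closed C \<Longrightarrow> x \<in> supp \<Pi>\<^sub>1 (P \<curlywedge>\<^bsub>\<Pi>\<^sub>1\<^esub> C) \<Longrightarrow>
      x \<in> supp \<Pi>\<^sub>1 (P \<curlywedge>\<^bsub>\<Pi>\<^sub>1\<^esub> C \<curlywedge>\<^bsub>\<Pi>\<^sub>1\<^esub> cball x R\<^sub>P)"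
    using assms(12) unfolding consists_of_bounded_components_def by blast
  obtain D where D: "Delone D" and PD: "locally_derivable ?G \<Pi>\<^sub>1 P (UD ?A) D"
    using assms(13) unfolding Delone_deriving_def by blast
  have Dc: "D \<in> carrier (UD ?A)"
    using D by (simp add: UD_def Delone_def)
  obtain R\<^sub>1 where R\<^sub>1: "0 \<le> R\<^sub>1" and
    PD: "\<And>g z R. g \<in> \<Gamma> \<Longrightarrow> 0 \<le> R \<Longrightarrow> X.agree P g z (R + R\<^sub>1) \<Longrightarrow> U.agree D g z R"
    using iffD1[OF locally_derivable_iff_agree[OF X.euclidean_pattern_space_axioms U assms(11) Dc] PD]
    by blast
  have U_agree: "U.agree D g z R \<longleftrightarrow> g ` D \<inter> cball z R = D \<inter> cball z R" for g z R
    using Dc unfolding U.agree_def by (simp add: UD_def)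
  obtain r\<^sub>0 where r\<^sub>0: "0 < r\<^sub>0" "\<And>x y. x \<in> D \<Longrightarrow> y \<in> D \<Longrightarrow> x \<noteq> y \<Longrightarrow> r\<^sub>0 < dist x y"
    using D unfolding Delone_def uniformly_discrete_def by blast
  obtain d where d: "0 < d" "\<And>z. D \<inter> interior (cball z d) \<noteq> {}"
    using D unfolding Delone_def relatively_dense_def by blast
  define r where "r = min r\<^sub>0 d"
  define l where "l = (DIM(real^'n) + 2) * d"
  \<comment> \<open>Agreement on balls of radius \<open>L\<close> has to determine \<open>D\<close> within distance \<open>l\<close> and to cover the
    components of \<open>P\<close> at all points within distance \<open>d\<close>.\<close>
  define L where "L = max (l + R\<^sub>1) (d + R\<^sub>P)"
  have l0: "0 \<le> l"
    using d by (simp add: l_def)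
  interpret local_symmetries \<Gamma> D r d l "\<lambda>g x. X.agree P g x L"
  proof
    show "0 < r" "r \<le> d" "l = (DIM(real^'n) + 2) * d"
      using r\<^sub>0(1) d(1) by (simp_all add: r_def l_def)
    show "r \<le> dist x y" if "x \<in> D" "y \<in> D" "x \<noteq> y" for x y
      using r\<^sub>0(2)[OF that] by (simp add: r_def)
    show "\<exists>x\<in>D. dist z x \<le> d" for z
    proof -
      obtain x where "x \<in> D" "x \<in> cball z d"
        using d(2)[of z] interior_subset[of "cball z d"] by blast
      then show ?thesis
        by auto
    qed
    show "X.agree P id x L" for x
      by (rule X.agree_id[OF assms(11)])
    show "X.agree P (inv_into UNIV g) (inv_into UNIV g x) L" if "g \<in> \<Gamma>" "X.agree P g x L" for g x
      by (rule X.agree_inv[OF that(2,1) assms(11)])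
    show "X.agree P (g \<circ> h) (g x) L"
      if "g \<in> \<Gamma>" "h \<in> \<Gamma>" "X.agree P h x L" "X.agree P g (g x) L" for g h x
      by (rule X.agree_comp[OF that(3,4,1,2) assms(11)])
    show "g ` D \<inter> cball x l = D \<inter> cball x l" if "g \<in> \<Gamma>" "X.agree P g x L" for g x
    proof -
      have "X.agree P g x (l + R\<^sub>1)"
        by (rule X.agree_subset[OF that(2,1) assms(11)]) (simp add: L_def subset_cball)
      then show ?thesis
        using PD[OF that(1) l0] U_agree by blast
    qed
  qed
  \<comment> \<open>The minimal distance of points of the code; copies at these points have to be compatible.\<close>
  define s where "s = \<delta> * \<mu> ^ DIM(real^'n) * (r / 4)"
  have s0: "0 < s"
    using \<delta>_pos \<mu>_pos r_pos by (simp add: s_def)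
  define \<rho> where "\<rho> = s / 8"
  have \<rho>0: "0 < \<rho>"
    using s0 by (simp add: \<rho>_def)
  obtain B where B: "symmetric_building_block ?G ?A \<Pi>\<^sub>2 \<Sigma>' \<rho> B"
    using assms(10) \<rho>0 by blast
  interpret Y: symmetric_block \<Gamma> \<Pi>\<^sub>2 \<Sigma>' \<rho> B
    by (intro symmetric_block.intro symmetric_block_axioms.intro Y assms(7-9) \<rho>0 B)
  have sep: "4 * \<rho> < dist (g e) (g f)" if "e \<in> code" "f \<in> code" "g e \<noteq> g f" "g \<in> \<Gamma>" for e f g
  proof -
    have "s \<le> dist e f"
      unfolding s_def using code_separated[OF that(1,2)] that(3) by blast
    then show ?thesis
      using s0 X.dist_isometry[OF that(4), of e f] by (simp add: \<rho>_def)
  qed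
  have far: "\<exists>x\<in>g ` code. R < dist z x" if g: "g \<in> \<Gamma>" for g z R
  proof -
    obtain b :: "real^'n" where b: "b \<in> Basis"
      using nonempty_Basis by blast
    let ?z = "inv_into UNIV g z"
    obtain x where x: "x \<in> D" "dist (?z + (\<bar>R\<bar> + d + 1) *\<^sub>R b) x \<le> d"
      using D_dense by blast
    have "dist ?z (?z + (\<bar>R\<bar> + d + 1) *\<^sub>R b) = \<bar>R\<bar> + d + 1"
      using b d by (simp add: dist_norm)
    then have "R < dist ?z x"
      using dist_triangle2[of ?z "?z + (\<bar>R\<bar> + d + 1) *\<^sub>R b" x] x(2) by linarith
    also have "dist ?z x = dist z (g x)"
      using X.dist_isometry[OF g, of ?z x] X.inv_isometry_apply(2)[OF g, of z] by simp
    finally show ?thesis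
      using x(1) by (auto simp: code_def)
  qed
  have sep1: "4 * \<rho> < dist e f" if "e \<in> code" "f \<in> code" "e \<noteq> f" for e f
    using sep[of e f id] that by simp
  have far1: "\<exists>x\<in>code. R < dist z x" for z R
    using far[OF X.id_mem] by simp
  obtain S where S: "S \<in> \<Sigma>'" "Y.glues code S"
    using Y.ex_glues[OF sep1 far1] by blast
  have Sc: "S \<in> carrier \<Pi>\<^sub>2"
    using S(2) by (rule Y.glues_carrier)
  have PS: "locally_derivable ?G \<Pi>\<^sub>1 P \<Pi>\<^sub>2 S"
  proof (rule iffD2[OF locally_derivable_iff_agree[OF X.euclidean_pattern_space_axioms Y assms(11) Sc]],
      intro exI[of _ "\<rho> + r + L"] conjI ballI allI impI)
    show "0 \<le> \<rho> + r + L"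
      using \<rho>0 r_pos R\<^sub>1 l0 by (simp add: L_def)
    fix g z and R :: real
    assume g: "g \<in> \<Gamma>" and ag: "X.agree P g z (R + (\<rho> + r + L))"
    have "g ` code \<inter> cball z (R + \<rho>) = code \<inter> cball z (R + \<rho>)"
    proof (rule local_symmetry_imp_code_eq[OF g])
      fix y assume "y \<in> cball z (R + \<rho> + r)"
      then have "cball y L \<subseteq> cball z (R + (\<rho> + r + L))"
        by (simp add: cball_subset_cball_iff dist_commute)
      then show "X.agree P g y L"
        by (rule X.agree_subset[OF ag g assms(11)])
    qed
    then show "Y.agree S g z R"
      unfolding Y.agree_def
      by (intro Y.glues_cut_cong[OF Y.glues_act[OF g S(2)] S(2) far[OF g] far1])
  qed
  have SP: "locally_derivable ?G \<Pi>\<^sub>2 S \<Pi>\<^sub>1 P"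
  proof (rule iffD2[OF locally_derivable_iff_agree[OF Y X.euclidean_pattern_space_axioms Sc assms(11)]],
      intro exI[of _ "\<rho> + (2 * l + d)"] conjI ballI allI impI)
    show "0 \<le> \<rho> + (2 * l + d)"
      using \<rho>0 l0 d by simp
    fix g z and R :: real
    assume g: "g \<in> \<Gamma>" and R: "0 \<le> R" and ag: "Y.agree S g z (R + (\<rho> + (2 * l + d)))"
    let ?F = "D \<inter> cball z (R + d)"
    have mem: "e \<in> g ` code \<longleftrightarrow> e \<in> code" if e: "e \<in> cball z (R + (2 * l + d))" for e
    proof -
      have "cball e \<rho> \<subseteq> cball z (R + (\<rho> + (2 * l + d)))"
        using e by (simp add: cball_subset_cball_iff dist_commute)
      then have "Y.agree S g e \<rho>"
        by (rule Y.agree_subset[OF ag g Sc])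
      moreover have "e \<in> g ` code \<longleftrightarrow> act \<Pi>\<^sub>2 g S \<curlywedge>\<^bsub>\<Pi>\<^sub>2\<^esub> cball e \<rho> = Y.copy e"
      proof (rule Y.glues_mem_iff[OF Y.glues_act[OF g S(2)]])
        show "4 * \<rho> < dist x y" if "x \<in> g ` code" "y \<in> g ` code" "x \<noteq> y" for x y
          using that sep[OF _ _ _ g] by blast
      qed (rule far[OF g])
      moreover have "e \<in> code \<longleftrightarrow> S \<curlywedge>\<^bsub>\<Pi>\<^sub>2\<^esub> cball e \<rho> = Y.copy e"
        by (rule Y.glues_mem_iff[OF S(2) sep1 far1])
      ultimately show ?thesis
        by (simp add: Y.agree_def)
    qed
    show "X.agree P g z R"
    proof (rule X.agree_if_locally_agree[OF assms(5,11) g bc, where F = ?F and L = L])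
      show "finite ?F"
        using uniform_discrete_finite_iff[of ?F] D_uniform_discrete uniform_discrete_subset
        by (meson Int_lower1 bounded_Int bounded_cball)
      have near: "\<exists>x\<in>?F. dist w x \<le> d" if "w \<in> cball z R" for w
      proof -
        obtain x where "x \<in> D" "dist w x \<le> d"
          using D_dense by blast
        moreover from this have "dist z x \<le> R + d"
          using that dist_triangle[of z x w] by simp
        ultimately show ?thesis
          by auto
      qed
      show "?F \<noteq> {}"
        using near[of z] R by auto
      show "\<exists>x\<in>?F. cball w R\<^sub>P \<subseteq> cball x L" if w: "w \<in> cball z R" for w
      proof -
        obtain x where x: "x \<in> ?F" "dist w x \<le> d"
          using near[OF w] by blast
        have "d + R\<^sub>P \<le> L"
          by (simp add: L_def)
        then have "cball w R\<^sub>P \<subseteq> cball x L"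
          using x(2) by (simp add: cball_subset_cball_iff)
        then show ?thesis
          using x(1) by blast
      qed
      fix x assume x: "x \<in> ?F"
      have "e \<in> g ` code \<longleftrightarrow> e \<in> code" if "e \<in> cball x (2 * l)" for e
        using mem[of e] that x dist_triangle[of z e x] by simp
      then have "g ` code \<inter> cball x (2 * l) = code \<inter> cball x (2 * l)"
        by blast
      then show "X.agree P g x L"
        using code_eq_imp_local_symmetry[OF g] x by blast
    qed
  qed
  have "relatively_dense (supp \<Pi>\<^sub>2 S)"
    unfolding relatively_dense_def
  proof (intro exI[of _ "d + \<rho> + 1"] conjI allI)
    show "0 < d + \<rho> + 1"
      using d \<rho>0 by simp
    fix z
    obtain x where x: "x \<in> D" "dist z x \<le> d"
      using D_dense by blast
    then have "x \<in> code"
      by (simp add: code_def)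
    then have "S \<curlywedge>\<^bsub>\<Pi>\<^sub>2\<^esub> cball x \<rho> = Y.copy x"
      using Y.glues_mem_iff[OF S(2) sep1 far1] by blast
    then have sub: "supp \<Pi>\<^sub>2 (Y.copy x) \<subseteq> supp \<Pi>\<^sub>2 S \<inter> cball x \<rho>"
      using Y.supp_cut_subset[OF Sc closed_cball, of x \<rho>] by simp
    obtain p where "p \<in> supp \<Pi>\<^sub>2 (Y.copy x)"
      using Y.supp_copy_nonempty by blast
    then have "p \<in> supp \<Pi>\<^sub>2 S" "dist x p \<le> \<rho>"
      using sub by auto
    moreover from this have "dist z p < d + \<rho> + 1"
      using x dist_triangle[of z p x] by linarith
    ultimately show "supp \<Pi>\<^sub>2 S \<inter> interior (cball z (d + \<rho> + 1)) \<noteq> {}"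
      by (auto simp: interior_cball)
  qed
  then show ?thesis
    using S(1) PS SP unfolding mutually_locally_derivable_def by blast
qed

end
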